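(* Let $p,m,n\ge 1$, $M\ge 1$ be integers, let $N$ be the number of workers, and let $\mathbb{F}$ be a sufficiently large finite field. For private coded matrix multiplication (as described in the context) there exist linear coding schemes that achieve a recovery threshold of $2R(p,m,n)$. For private and secure distributed matrix multiplication there exist linear coding schemes that achieve a recovery threshold of $2R(p,m,n)+1$.
   Context: Private coded matrix multiplication: given $A\in\mathbb{F}^{s\times t}$ and a list $\boldsymbol{B}=(B^{(1)},\dots,B^{(M)})$ with $B^{(\ell)}\in\mathbb{F}^{s\times r}$, and a request index $D\in[M]$, the master wants $A^\intercal B^{(D)}$. Assume $p\mid s$, $m\mid t$, $n\mid r$; $A$ is partitioned into a $p$-by-$m$ grid of equal-size blocks and each $B^{(\ell)}$ into a $p$-by-$n$ grid of equal-size blocks. There are $N$ workers. The master sends worker $i$ a (possibly random) query $Q_i$ depending on $D$, together with a coded matrix $\tilde A_i\in\mathbb{F}^{\frac{s}{p}\times\frac{t}{m}}$ that is a linear combination of the blocks of $A$ (possibly padded with i.i.d. uniformly random key matrices of the same size). Worker $i$ encodes $\boldsymbol{B}$ into $\tilde B_i\in\mathbb{F}^{\frac{s}{p}\times\frac{r}{n}}$, a linear combination of the blocks of the $B^{(\ell)}$ with coefficients determined by $Q_i$, computes $\tilde A_i^\intercal\tilde B_i$ and returns it. The master decodes by linear combinations of received results, with coefficients that may depend on $D$ and the queries. A scheme achieves recovery threshold $K$ if the master can recover $A^\intercal B^{(D)}$ from the results of any subset of $K$ workers. Privacy requirement: $I(D;Q_i,\tilde A_i,\boldsymbol{B})=0$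 for every $i\in[N]$, where $A,\boldsymbol{B},D$ are uniformly random. Private and secure: in addition $I(\tilde A_i;A)=0$ for every $i\in[N]$ when $A$ is uniformly random. $R(p,m,n)$ denotes the bilinear complexity (tensor rank of the matrix multiplication tensor) of multiplying an $m$-by-$p$ matrix by a $p$-by-$n$ matrix. *)

theory Defs
  imports "HOL-Probability.Probability" "HOL-Algebra.Ring"
begin

type_synonym 'c mat = "nat \<Rightarrow> nat \<Rightarrow> 'c"

definition mats :: "('c,'e) ring_scheme \<Rightarrow> nat \<Rightarrow> nat \<Rightarrow> 'c mat set" where
  "mats F a b = {X. \<forall>i j. X i j \<in> (if i < a \<and> j < b then carrier F else {\<zero>\<^bsub>F\<^esub>})}"

definition mat_list :: "('c,'e) ring_scheme \<Rightarrow> nat \<Rightarrow> nat \<Rightarrow> nat \<Rightarrow> (nat \<Rightarrow> 'c mat) set" where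
  "mat_list F M a b = {Bs. \<forall>l. Bs l \<in> (if l < M then mats F a b else {\<lambda>i j. \<zero>\<^bsub>F\<^esub>})}"

definition block :: "('c,'e) ring_scheme \<Rightarrow> nat \<Rightarrow> nat \<Rightarrow> 'c mat \<Rightarrow> nat \<Rightarrow> nat \<Rightarrow> 'c mat" where
  "block F h w X bi bj = (\<lambda>i j. if i < h \<and> j < w then X (bi * h + i) (bj * w + j) else \<zero>\<^bsub>F\<^esub>)"

definition tmul :: "('c,'e) ring_scheme \<Rightarrow> nat \<Rightarrow> nat \<Rightarrow> nat \<Rightarrow> 'c mat \<Rightarrow> 'c mat \<Rightarrow> 'c mat" where
  "tmul F k a b X Y = (\<lambda>i j. if i < a \<and> j < b
      then (\<Oplus>\<^bsub>F\<^esub> l\<in>{..<k}. X l i \<otimes>\<^bsub>F\<^esub> Y l j) else \<zero>\<^bsub>F\<^esub>)"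

definition lincomb :: "('c,'e) ring_scheme \<Rightarrow> nat \<Rightarrow> nat \<Rightarrow> 'x set \<Rightarrow> ('x \<Rightarrow> 'c) \<Rightarrow> ('x \<Rightarrow> 'c mat) \<Rightarrow> 'c mat" where
  "lincomb F a b I c Xs = (\<lambda>i j. if i < a \<and> j < b
      then (\<Oplus>\<^bsub>F\<^esub> x\<in>I. c x \<otimes>\<^bsub>F\<^esub> Xs x i j) else \<zero>\<^bsub>F\<^esub>)"

text \<open>Bilinear complexity R(p,m,n) over F: tensor rank of the tensor of multiplying
  an m x p matrix by a p x n matrix, T((j,l),(l',k),(j',k')) = [j=j'][l=l'][k=k'].\<close>
definition mm_rank :: "('c,'e) ring_scheme \<Rightarrow> nat \<Rightarrow> nat \<Rightarrow> nat \<Rightarrow> nat" where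
  "mm_rank F p m n = (LEAST R. \<exists>\<alpha> \<beta> \<gamma>.
      (\<forall>r j l. \<alpha> r j l \<in> carrier F) \<and> (\<forall>r l k. \<beta> r l k \<in> carrier F) \<and>
      (\<forall>r j k. \<gamma> r j k \<in> carrier F) \<and>
      (\<forall>j l l' k j' k'. j < m \<longrightarrow> l < p \<longrightarrow> l' < p \<longrightarrow> k < n \<longrightarrow> j' < m \<longrightarrow> k' < n \<longrightarrow>
         (if j = j' \<and> l = l' \<and> k = k' then \<one>\<^bsub>F\<^esub> else \<zero>\<^bsub>F\<^esub>) =
         (\<Oplus>\<^bsub>F\<^esub> r\<in>{..<R}. \<alpha> r j l \<otimes>\<^bsub>F\<^esub> \<beta> r l' k \<otimes>\<^bsub>F\<^esub> \<gamma> r j' k')))"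

text \<open>The random experiment: A uniform, B = (B^(0),...,B^(M-1)) uniform, D uniform on
  {0..<M}, L i.i.d. uniform key matrices of size (s/p) x (t/m), and the master's
  private randomness omega drawn from mu; all independent.\<close>
definition pm_experiment :: "('c,'e) ring_scheme \<Rightarrow> nat \<Rightarrow> nat \<Rightarrow> nat \<Rightarrow> nat \<Rightarrow> nat \<Rightarrow> nat \<Rightarrow> nat
    \<Rightarrow> (nat \<Rightarrow> 'c) pmf
    \<Rightarrow> ('c mat \<times> (nat \<Rightarrow> 'c mat) \<times> nat \<times> (nat \<Rightarrow> 'c mat) \<times> (nat \<Rightarrow> 'c)) pmf" where
  "pm_experiment F p m M s t r L \<mu> = do {
     A \<leftarrow> pmf_of_set (mats F s t);
     Bs \<leftarrow> pmf_of_set (mat_list F M s r);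
     D \<leftarrow> pmf_of_set {..<M};
     Ks \<leftarrow> pmf_of_set (mat_list F L (s div p) (t div m));
     \<omega> \<leftarrow> \<mu>;
     return_pmf (A, Bs, D, Ks, \<omega>) }"

definition coded_A :: "('c,'e) ring_scheme \<Rightarrow> nat \<Rightarrow> nat \<Rightarrow> nat \<Rightarrow> nat \<Rightarrow> nat
    \<Rightarrow> (nat \<Rightarrow> nat \<Rightarrow> 'c) \<Rightarrow> (nat \<Rightarrow> 'c) \<Rightarrow> 'c mat \<Rightarrow> (nat \<Rightarrow> 'c mat) \<Rightarrow> 'c mat" where
  "coded_A F p m s t L ca ck A Ks = (\<lambda>i j. if i < s div p \<and> j < t div m then
      (\<Oplus>\<^bsub>F\<^esub> lj\<in>{..<p} \<times> {..<m}. ca (fst lj) (snd lj) \<otimes>\<^bsub>F\<^esub>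
            block F (s div p) (t div m) A (fst lj) (snd lj) i j)
      \<oplus>\<^bsub>F\<^esub> (\<Oplus>\<^bsub>F\<^esub> u\<in>{..<L}. ck u \<otimes>\<^bsub>F\<^esub> Ks u i j)
     else \<zero>\<^bsub>F\<^esub>)"

definition coded_B :: "('c,'e) ring_scheme \<Rightarrow> nat \<Rightarrow> nat \<Rightarrow> nat \<Rightarrow> nat \<Rightarrow> nat
    \<Rightarrow> (nat \<Rightarrow> nat \<Rightarrow> nat \<Rightarrow> 'c) \<Rightarrow> (nat \<Rightarrow> 'c mat) \<Rightarrow> 'c mat" where
  "coded_B F p n M s r Q Bs = (\<lambda>i j. if i < s div p \<and> j < r div n then
      (\<Oplus>\<^bsub>F\<^esub> x\<in>{..<M} \<times> {..<p} \<times> {..<n}. Q (fst x) (fst (snd x)) (snd (snd x)) \<otimes>\<^bsub>F\<^esub>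
            block F (s div p) (r div n) (Bs (fst x)) (fst (snd x)) (snd (snd x)) i j)
     else \<zero>\<^bsub>F\<^esub>)"

text \<open>Existence of a linear scheme for private coded matrix multiplication with N workers
  and recovery threshold K; if secure is True, additionally I(A_i~;A)=0.
  ca i D omega l j, ck i D omega u : coefficients of the coded A of worker i;
  q i D omega : query of worker i (coefficients for coded B);
  d S D omega j k i : decoding coefficient of worker i in S for output block (j,k).\<close>
definition linear_scheme_exists :: "bool \<Rightarrow> ('c,'e) ring_scheme \<Rightarrow> nat \<Rightarrow> nat \<Rightarrow> nat \<Rightarrow> nat \<Rightarrow> nat
    \<Rightarrow> nat \<Rightarrow> nat \<Rightarrow> nat \<Rightarrow> nat \<Rightarrow> bool" where
  "linear_scheme_exists secure F p m n M N s t r K \<longleftrightarrow>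
   (\<exists>(L::nat) (\<mu>::(nat \<Rightarrow> 'c) pmf)
      (ca :: nat \<Rightarrow> nat \<Rightarrow> (nat \<Rightarrow> 'c) \<Rightarrow> nat \<Rightarrow> nat \<Rightarrow> 'c)
      (ck :: nat \<Rightarrow> nat \<Rightarrow> (nat \<Rightarrow> 'c) \<Rightarrow> nat \<Rightarrow> 'c)
      (q :: nat \<Rightarrow> nat \<Rightarrow> (nat \<Rightarrow> 'c) \<Rightarrow> nat \<Rightarrow> nat \<Rightarrow> nat \<Rightarrow> 'c)
      (d :: nat set \<Rightarrow> nat \<Rightarrow> (nat \<Rightarrow> 'c) \<Rightarrow> nat \<Rightarrow> nat \<Rightarrow> nat \<Rightarrow> 'c).
     let At = (\<lambda>i D \<omega> A Ks. coded_A F p m s t L (ca i D \<omega>) (ck i D \<omega>) A Ks);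
         Bt = (\<lambda>i D \<omega> Bs. coded_B F p n M s r (q i D \<omega>) Bs);
         Y = (\<lambda>i D \<omega> A Bs Ks. tmul F (s div p) (t div m) (r div n) (At i D \<omega> A Ks) (Bt i D \<omega> Bs));
         E = pm_experiment F p m M s t r L \<mu>
     in
     (\<forall>i D \<omega> l j u. i < N \<longrightarrow> D < M \<longrightarrow> \<omega> \<in> set_pmf \<mu> \<longrightarrow>
         ca i D \<omega> l j \<in> carrier F \<and> ck i D \<omega> u \<in> carrier F) \<and>
     (\<forall>i D \<omega> x l k. i < N \<longrightarrow> D < M \<longrightarrow> \<omega> \<in> set_pmf \<mu> \<longrightarrow> q i D \<omega> x l k \<in> carrier F) \<and>
     (\<forall>S D \<omega> j k i. D < M \<longrightarrow> \<omega> \<in> set_pmf \<mu> \<longrightarrow> d S D \<omega> j k i \<in> carrier F) \<and>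
     (\<forall>A Bs D Ks \<omega> S. A \<in> mats F s t \<longrightarrow> Bs \<in> mat_list F M s r \<longrightarrow> D < M \<longrightarrow>
         Ks \<in> mat_list F L (s div p) (t div m) \<longrightarrow> \<omega> \<in> set_pmf \<mu> \<longrightarrow>
         S \<subseteq> {..<N} \<longrightarrow> card S = K \<longrightarrow>
         (\<forall>j<m. \<forall>k<n. block F (t div m) (r div n) (tmul F s t r A (Bs D)) j k =
             lincomb F (t div m) (r div n) S (d S D \<omega> j k) (\<lambda>i. Y i D \<omega> A Bs Ks))) \<and>
     (\<forall>i<N. prob_space.mutual_information (measure_pmf E) 2 (count_space UNIV) (count_space UNIV)
         (\<lambda>(A, Bs, D, Ks, \<omega>). D)
         (\<lambda>(A, Bs, D, Ks, \<omega>). (q i D \<omega>, At i D \<omega> A Ks, Bs)) = 0) \<and>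
     (secure \<longrightarrow> (\<forall>i<N. prob_space.mutual_information (measure_pmf E) 2 (count_space UNIV) (count_space UNIV)
         (\<lambda>(A, Bs, D, Ks, \<omega>). At i D \<omega> A Ks)
         (\<lambda>(A, Bs, D, Ks, \<omega>). A) = 0)))"

end

theory Submission
  imports Defs
begin

text \<open>
  Fix a rank decomposition of the matrix multiplication tensor with \<open>R\<close> terms, so that
  \<open>A\<^sup>T B\<^sup>(\<^sup>D\<^sup>)\<close> is a linear combination of \<open>R\<close> products of coded blocks
  \<open>X\<^sub>e\<^sup>T Z\<^sub>e\<close>. Choose distinct field elements: \<open>y\<^sub>e\<close> for the terms and \<open>z\<^sub>i\<close> for the
  workers. Let \<open>f\<close> be the polynomial of degree at most \<open>R - 1\<close> with \<open>f(y\<^sub>e) = X\<^sub>e\<close>, and let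
  \<open>w\<close> be the polynomial of degree \<open>R\<close> vanishing exactly at the \<open>y\<^sub>e\<close>. Worker \<open>i\<close> gets \<open>f(z\<^sub>i)\<close>,
  and its query consists of the Lagrange coefficients of the \<open>Z\<^sub>e\<close> at \<open>z\<^sub>i\<close>, placed in the
  \<open>D\<close>-th slot, plus \<open>w(z\<^sub>i)\<close> times a uniformly random vector. As \<open>w(z\<^sub>i) \<noteq> 0\<close>, each single
  query is uniform whatever \<open>D\<close> is. The results are values at \<open>z\<^sub>i\<close> of a polynomial
  of degree at most \<open>2R - 1\<close> whose value at \<open>y\<^sub>e\<close> is \<open>X\<^sub>e\<^sup>T Z\<^sub>e\<close>, so \<open>2R\<close> of them determine
  it. For security, \<open>f\<close> is replaced by \<open>f + w K\<close> with a uniformly random key \<open>K\<close>, which raises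
  the degree by one.
\<close>

section \<open>Uniform distributions and independence\<close>

text \<open>Mutual information is the divergence of the joint law from the product of its marginals.
  Projecting the hypothesis shows that \<open>U\<close> and \<open>V\<close> are the marginals, so
  the two measures coincide.\<close>

lemma mutual_information_eq_0_of_pair_pmf:
  assumes "map_pmf (\<lambda>\<omega>. (X \<omega>, Y \<omega>)) P = pair_pmf U V"
  shows "prob_space.mutual_information (measure_pmf P) 2 (count_space UNIV) (count_space UNIV) X Y = 0"
proof -
  have U: "map_pmf X P = U"
    using arg_cong[OF assms, of "map_pmf fst"] by (simp add: map_pmf_comp map_fst_pair_pmf)
  have V: "map_pmf Y P = V"
    using arg_cong[OF assms, of "map_pmf snd"] by (simp add: map_pmf_comp map_snd_pair_pmf)
  have dX: "distr (measure_pmf P) (count_space UNIV) X = measure_pmf U"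
    using U by (simp add: map_pmf_rep_eq[symmetric])
  have dY: "distr (measure_pmf P) (count_space UNIV) Y = measure_pmf V"
    using V by (simp add: map_pmf_rep_eq[symmetric])
  \<comment> \<open>On uncountable types a product of discrete sigma-algebras can be smaller than
    the power set, so the equality is checked on rectangles instead of being read off from
    \<open>pair_pmf\<close>.\<close>
  have "measure_pmf U \<Otimes>\<^sub>M measure_pmf V
      = distr (measure_pmf P) (count_space UNIV \<Otimes>\<^sub>M count_space UNIV) (\<lambda>x. (X x, Y x))"
  proof (rule pair_measure_eqI)
    fix A B
    have "emeasure (distr (measure_pmf P) (count_space UNIV \<Otimes>\<^sub>M count_space UNIV)
            (\<lambda>x. (X x, Y x))) (A \<times> B) = emeasure (measure_pmf P) ((\<lambda>x. (X x, Y x)) -` (A \<times> B))"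
      by (subst emeasure_distr) (auto simp: space_pair_measure)
    also have "\<dots> = emeasure (measure_pmf (pair_pmf U V)) (A \<times> B)"
      by (simp add: assms[symmetric])
    also have "\<dots> = (\<integral>\<^sup>+ x. indicator (A \<times> B) x \<partial>pair_pmf U V)"
      by simp
    also have "\<dots> = (\<integral>\<^sup>+ a. \<integral>\<^sup>+ b. indicator A a * indicator B b \<partial>V \<partial>U)"
      by (simp only: nn_integral_pair_pmf' indicator_times fst_conv snd_conv)
    also have "\<dots> = emeasure (measure_pmf U) A * emeasure (measure_pmf V) B"
      by (simp add: nn_integral_cmult nn_integral_multc)
    finally show "emeasure (measure_pmf U) A * emeasure (measure_pmf V) B =
      emeasure (distr (measure_pmf P) (count_space UNIV \<Otimes>\<^sub>M count_space UNIV)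
            (\<lambda>x. (X x, Y x))) (A \<times> B)" by simp
  next
    show "sets (measure_pmf U \<Otimes>\<^sub>M measure_pmf V)
      = sets (distr (measure_pmf P) (count_space UNIV \<Otimes>\<^sub>M count_space UNIV) (\<lambda>x. (X x, Y x)))"
      unfolding sets_distr by (intro sets_pair_measure_cong sets_measure_pmf_count_space)
  qed (auto intro: prob_space_imp_sigma_finite prob_space_measure_pmf)
  moreover have "prob_space (distr (measure_pmf P) (count_space UNIV \<Otimes>\<^sub>M count_space UNIV) (\<lambda>x. (X x, Y x)))"
    by (rule prob_space.prob_space_distr[OF prob_space_measure_pmf]) (auto simp: space_pair_measure)
  ultimately show ?thesis
    unfolding prob_space.mutual_information_def[OF prob_space_measure_pmf] dX dY
    by (auto intro!: sigma_finite_measure.KL_same_eq_0 prob_space_imp_sigma_finite)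
qed

section \<open>Finiteness of the sample spaces\<close>

lemma finite_mats:
  assumes "finite (carrier F)"
  shows "finite (mats F a b)"
proof -
  let ?rows = "{x. \<forall>j. (j \<in> {..<b} \<longrightarrow> x j \<in> carrier F) \<and> (j \<notin> {..<b} \<longrightarrow> x j = \<zero>\<^bsub>F\<^esub>)}"
  let ?mats = "{X. \<forall>i. (i \<in> {..<a} \<longrightarrow> X i \<in> ?rows) \<and> (i \<notin> {..<a} \<longrightarrow> X i = (\<lambda>j. \<zero>\<^bsub>F\<^esub>))}"
  have "finite ?mats"
    by (intro finite_set_of_finite_funs finite_lessThan assms)
  moreover have "mats F a b \<subseteq> ?mats"
    by (force simp: mats_def split: if_splits)
  ultimately show ?thesis by (rule rev_finite_subset)
qed

lemma finite_mat_list: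
  assumes "finite (carrier F)"
  shows "finite (mat_list F L a b)"
proof -
  have "mat_list F L a b = {Bs. \<forall>l. (l \<in> {..<L} \<longrightarrow> Bs l \<in> mats F a b)
      \<and> (l \<notin> {..<L} \<longrightarrow> Bs l = (\<lambda>i j. \<zero>\<^bsub>F\<^esub>))}"
    by (auto simp: mat_list_def)
  then show ?thesis
    using finite_set_of_finite_funs[OF finite_lessThan finite_mats[OF assms]] by simp
qed

text \<open>Fixing the value off \<open>I\<close> keeps the set finite for finite \<open>I\<close>
  and a finite carrier, and lets an affine change of the values on \<open>I\<close> be a bijection
  of the set.\<close>

definition supported_funs :: "('c,'e) ring_scheme \<Rightarrow> 'x set \<Rightarrow> ('x \<Rightarrow> 'c) set" where
  "supported_funs F I = {f. \<forall>x. (x \<in> I \<longrightarrow> f x \<in> carrier F) \<and> (x \<notin> I \<longrightarrow> f x = \<zero>\<^bsub>F\<^esub>)}"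

lemma finite_supported_funs:
  "finite (carrier F) \<Longrightarrow> finite I \<Longrightarrow> finite (supported_funs F I)"
  unfolding supported_funs_def by (rule finite_set_of_finite_funs)

context field begin

lemma mats_closed: "X \<in> mats R a b \<Longrightarrow> X i j \<in> carrier R"
proof -
  assume "X \<in> mats R a b"
  then have "X i j \<in> (if i < a \<and> j < b then carrier R else {\<zero>})"
    by (simp add: mats_def)
  then show ?thesis by (simp split: if_splits)
qed

lemma mat_list_closed: "Bs \<in> mat_list R L a b \<Longrightarrow> Bs l i j \<in> carrier R"
proof -
  assume "Bs \<in> mat_list R L a b"
  then have "Bs l \<in> (if l < L then mats R a b else {\<lambda>i j. \<zero>})"
    by (simp add: mat_list_def)
  then show ?thesis using mats_closed by (auto split: if_splits)
qed

lemma mats_nonempty: "mats R a b \<noteq> {}"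
proof -
  have "(\<lambda>i j. \<zero>) \<in> mats R a b" by (simp add: mats_def)
  then show ?thesis by blast
qed

lemma mat_list_nonempty: "mat_list R L a b \<noteq> {}"
proof -
  have "(\<lambda>l i j. \<zero>) \<in> mat_list R L a b" by (simp add: mat_list_def mats_def)
  then show ?thesis by blast
qed

lemma supported_funs_nonempty: "supported_funs R I \<noteq> {}"
proof -
  have "(\<lambda>x. \<zero>) \<in> supported_funs R I" by (simp add: supported_funs_def)
  then show ?thesis by blast
qed

section \<open>Affine bijections as one-time pads\<close>

lemma affine_inverse:
  assumes "c \<in> carrier R" "c \<noteq> \<zero>" "v \<in> carrier R" "x \<in> carrier R"
  shows "inv c \<otimes> ((v \<oplus> c \<otimes> x) \<ominus> v) = x" and "v \<oplus> c \<otimes> (inv c \<otimes> (x \<ominus> v)) = x"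
proof -
  have c: "inv c \<in> carrier R" "inv c \<otimes> c = \<one>" "c \<otimes> inv c = \<one>"
    using assms field_Units by auto
  have "inv c \<otimes> ((v \<oplus> c \<otimes> x) \<ominus> v) = (inv c \<otimes> c) \<otimes> x"
    using assms(1,3,4) c(1) by algebra
  then show "inv c \<otimes> ((v \<oplus> c \<otimes> x) \<ominus> v) = x"
    using c assms by simp
  have "v \<oplus> c \<otimes> (inv c \<otimes> (x \<ominus> v)) = v \<oplus> (c \<otimes> inv c) \<otimes> (x \<ominus> v)"
    using assms(1,3,4) c(1) by algebra
  also have "\<dots> = x"
    unfolding c(3) using assms(3,4) by algebra
  finally show "v \<oplus> c \<otimes> (inv c \<otimes> (x \<ominus> v)) = x" .
qed

text \<open>The one-time pad: scaling by a nonzero \<open>c\<close> and shifting by \<open>v\<close>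
  permutes the set, so a uniform \<open>f\<close> stays uniform and hides \<open>v\<close>.\<close>

lemma bij_betw_affine:
  assumes "c \<in> carrier R" "c \<noteq> \<zero>" "\<And>x. x \<in> I \<Longrightarrow> v x \<in> carrier R"
  shows "bij_betw (\<lambda>f x. if x \<in> I then v x \<oplus> c \<otimes> f x else \<zero>) (supported_funs R I) (supported_funs R I)"
proof (rule bij_betw_byWitness[where f' = "\<lambda>f x. if x \<in> I then inv c \<otimes> (f x \<ominus> v x) else \<zero>"])
  have "inv c \<in> carrier R" using assms field_Units by auto
  then show "(\<lambda>f x. if x \<in> I then inv c \<otimes> (f x \<ominus> v x) else \<zero>) ` supported_funs R I \<subseteq> supported_funs R I"
    using assms by (auto simp: supported_funs_def)
  show "(\<lambda>f x. if x \<in> I then v x \<oplus> c \<otimes> f x else \<zero>) ` supported_funs R I \<subseteq> supported_funs R I"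
    using assms by (auto simp: supported_funs_def)
  show "\<forall>f\<in>supported_funs R I. (\<lambda>x. if x \<in> I then inv c \<otimes>
      ((if x \<in> I then v x \<oplus> c \<otimes> f x else \<zero>) \<ominus> v x) else \<zero>) = f"
    using affine_inverse(1)[OF assms(1,2)] assms(3) by (auto simp: supported_funs_def)
  show "\<forall>f\<in>supported_funs R I. (\<lambda>x. if x \<in> I then v x \<oplus> c \<otimes>
      (if x \<in> I then inv c \<otimes> (f x \<ominus> v x) else \<zero>) else \<zero>) = f"
    using affine_inverse(2)[OF assms(1,2)] assms(3) by (auto simp: supported_funs_def)
qed

text \<open>The same pad for a matrix masked by one key. The map is a composition: flatten the key
  to a function of index pairs, apply the affine permutation, curry back.\<close>

lemma bij_betw_mats_affine:
  assumes c: "c \<in> carrier R" "c \<noteq> \<zero>" and v: "\<And>i j. i < a \<Longrightarrow> j < b \<Longrightarrow> v i j \<in> carrier R"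
  shows "bij_betw (\<lambda>Ks i j. if i < a \<and> j < b then v i j \<oplus> c \<otimes> Ks 0 i j else \<zero>)
           (mat_list R 1 a b) (mats R a b)"
proof -
  let ?I = "{..<a} \<times> {..<b}"
  have 1: "bij_betw (\<lambda>Ks (i, j). Ks 0 i j) (mat_list R 1 a b) (supported_funs R ?I)"
  \<comment> \<open>A key list of length one is determined by its entry 0, all later entries being
    zero matrices.\<close>
  proof (rule bij_betw_byWitness[where f' = "\<lambda>f l i j. if l = 0 then f (i, j) else \<zero>"])
    show "\<forall>Ks\<in>mat_list R 1 a b. (\<lambda>l i j. if l = 0 then case (i, j) of (i, j) \<Rightarrow> Ks 0 i j else \<zero>) = Ks"
      by (auto simp: mat_list_def fun_eq_iff)
    show "(\<lambda>Ks (i, j). Ks 0 i j) ` mat_list R 1 a b \<subseteq> supported_funs R ?I"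
    proof
      fix f assume "f \<in> (\<lambda>Ks (i, j). Ks 0 i j) ` mat_list R 1 a b"
      then obtain Ks where Ks: "Ks \<in> mat_list R 1 a b" "f = (\<lambda>(i, j). Ks 0 i j)"
        by blast
      define X where "X = Ks 0"
      have X: "X \<in> mats R a b" "f = (\<lambda>(i, j). X i j)"
        using Ks by (auto simp: mat_list_def X_def dest: spec[of _ 0])
      have "X i j \<in> (if i < a \<and> j < b then carrier R else {\<zero>})" for i j
        using X(1) by (simp add: mats_def)
      then show "f \<in> supported_funs R ?I"
        unfolding X(2) supported_funs_def by (simp add: if_split)
    qed
    show "(\<lambda>f l i j. if l = 0 then f (i, j) else \<zero>) ` supported_funs R ?I \<subseteq> mat_list R 1 a b"
      by (auto simp: mat_list_def mats_def supported_funs_def)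
  qed auto
  have 2: "bij_betw curry (supported_funs R ?I) (mats R a b)"
  proof (rule bij_betw_byWitness[where f' = case_prod])
    show "curry ` supported_funs R ?I \<subseteq> mats R a b"
      by (auto simp: mats_def supported_funs_def)
    show "case_prod ` mats R a b \<subseteq> supported_funs R ?I"
    proof
      fix f assume "f \<in> case_prod ` mats R a b"
      then obtain X where X: "X \<in> mats R a b" "f = (\<lambda>(i, j). X i j)"
        by auto
      have "X i j \<in> (if i < a \<and> j < b then carrier R else {\<zero>})" for i j
        using X(1) by (simp add: mats_def)
      then show "f \<in> supported_funs R ?I"
        unfolding X(2) supported_funs_def by (simp add: if_split)
    qed
  qed auto
  have 3: "bij_betw (\<lambda>f x. if x \<in> ?I then case_prod v x \<oplus> c \<otimes> f x else \<zero>)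
      (supported_funs R ?I) (supported_funs R ?I)"
    by (rule bij_betw_affine[OF c]) (use v in auto)
  have "bij_betw (curry \<circ> (\<lambda>f x. if x \<in> ?I then case_prod v x \<oplus> c \<otimes> f x else \<zero>) \<circ> (\<lambda>Ks (i, j). Ks 0 i j))
      (mat_list R 1 a b) (mats R a b)"
    using bij_betw_trans[OF 1 bij_betw_trans[OF 3 2]] by (simp only: comp_assoc)
  moreover have "curry \<circ> (\<lambda>f x. if x \<in> ?I then case_prod v x \<oplus> c \<otimes> f x else \<zero>) \<circ> (\<lambda>Ks (i, j). Ks 0 i j)
      = (\<lambda>Ks i j. if i < a \<and> j < b then v i j \<oplus> c \<otimes> Ks 0 i j else \<zero>)"
    by (auto simp: fun_eq_iff)
  ultimately show ?thesis by (rule subst[rotated])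
qed

end

section \<open>Polynomial functions and interpolation\<close>

text \<open>\<open>poly_fun F d h\<close>: on the carrier, \<open>h\<close> agrees with a polynomial of degree at most \<open>d\<close>, given
  in Horner form.\<close>

primrec poly_fun :: "('c,'e) ring_scheme \<Rightarrow> nat \<Rightarrow> ('c \<Rightarrow> 'c) \<Rightarrow> bool" where
  "poly_fun F 0 h \<longleftrightarrow> (\<exists>c\<in>carrier F. \<forall>x\<in>carrier F. h x = c)"
| "poly_fun F (Suc d) h \<longleftrightarrow>
    (\<exists>c\<in>carrier F. \<exists>g. poly_fun F d g \<and> (\<forall>x\<in>carrier F. h x = c \<oplus>\<^bsub>F\<^esub> x \<otimes>\<^bsub>F\<^esub> g x))"

context field begin

lemma poly_fun_closed: "poly_fun R d h \<Longrightarrow> x \<in> carrier R \<Longrightarrow> h x \<in> carrier R"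
  by (induction d arbitrary: h) auto

lemma poly_fun_cong:
  assumes "poly_fun R d g" "\<And>x. x \<in> carrier R \<Longrightarrow> h x = g x"
  shows "poly_fun R d h"
  using assms by (cases d) auto

lemma poly_fun_const: "c \<in> carrier R \<Longrightarrow> poly_fun R d (\<lambda>x. c)"
proof (induction d arbitrary: c)
  case (Suc d)
  have "\<forall>x\<in>carrier R. c = c \<oplus> x \<otimes> \<zero>" using Suc.prems by simp
  with Suc.IH[OF zero_closed] Suc.prems show ?case unfolding poly_fun.simps by blast
qed auto

lemma poly_fun_Suc: "poly_fun R d h \<Longrightarrow> poly_fun R (Suc d) h"
proof (induction d arbitrary: h)
  case 0
  then obtain c where "c \<in> carrier R" "\<forall>x\<in>carrier R. h x = c" by auto
  then show ?case by (intro poly_fun_cong[OF poly_fun_const[of c]]) auto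
next
  case (Suc d)
  then show ?case by (metis poly_fun.simps(2))
qed

lemma poly_fun_mono: "poly_fun R d h \<Longrightarrow> d \<le> e \<Longrightarrow> poly_fun R e h"
  by (rotate_tac, induction e rule: dec_induct) (use poly_fun_Suc in auto)

lemma poly_fun_add:
  "poly_fun R d f \<Longrightarrow> poly_fun R d g \<Longrightarrow> poly_fun R d (\<lambda>x. f x \<oplus> g x)"
proof (induction d arbitrary: f g)
  case (Suc d)
  obtain a f' where f: "a \<in> carrier R" "poly_fun R d f'" "\<And>x. x \<in> carrier R \<Longrightarrow> f x = a \<oplus> x \<otimes> f' x"
    using Suc.prems(1) by auto
  obtain b g' where g: "b \<in> carrier R" "poly_fun R d g'" "\<And>x. x \<in> carrier R \<Longrightarrow> g x = b \<oplus> x \<otimes> g' x"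
    using Suc.prems(2) by auto
  have "f x \<oplus> g x = (a \<oplus> b) \<oplus> x \<otimes> (f' x \<oplus> g' x)" if x: "x \<in> carrier R" for x
  proof -
    have "f' x \<in> carrier R" "g' x \<in> carrier R" using f g x poly_fun_closed by auto
    then show ?thesis using x f(1) g(1) f(3)[OF x] g(3)[OF x] by algebra
  qed
  moreover have "a \<oplus> b \<in> carrier R" using f g by simp
  ultimately show ?case using Suc.IH[OF f(2) g(2)] unfolding poly_fun.simps by blast
qed force

lemma poly_fun_smult:
  "c \<in> carrier R \<Longrightarrow> poly_fun R d f \<Longrightarrow> poly_fun R d (\<lambda>x. c \<otimes> f x)"
proof (induction d arbitrary: f)
  case (Suc d)
  obtain a f' where f: "a \<in> carrier R" "poly_fun R d f'" "\<And>x. x \<in> carrier R \<Longrightarrow> f x = a \<oplus> x \<otimes> f' x"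
    using Suc.prems(2) by auto
  have "c \<otimes> f x = (c \<otimes> a) \<oplus> x \<otimes> (c \<otimes> f' x)" if x: "x \<in> carrier R" for x
  proof -
    have "f' x \<in> carrier R" using f x poly_fun_closed by auto
    then show ?thesis using x f(1) Suc.prems(1) f(3)[OF x] by algebra
  qed
  moreover have "c \<otimes> a \<in> carrier R" using f Suc.prems by simp
  ultimately show ?case using Suc.IH[OF Suc.prems(1) f(2)] unfolding poly_fun.simps by blast
qed force

text \<open>Horner step: (a + x f') g = a g + x (f' g), where the induction hypothesis bounds the
  degree of f' g.\<close>

lemma poly_fun_mult:
  "poly_fun R d f \<Longrightarrow> poly_fun R e g \<Longrightarrow> poly_fun R (d + e) (\<lambda>x. f x \<otimes> g x)"
proof (induction d arbitrary: f)
  case 0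
  then obtain c where c: "c \<in> carrier R" "\<forall>x\<in>carrier R. f x = c" by auto
  have "poly_fun R e (\<lambda>x. f x \<otimes> g x)"
    by (rule poly_fun_cong[OF poly_fun_smult[OF c(1) 0(2)]]) (use c in auto)
  then show ?case by simp
next
  case (Suc d)
  obtain a f' where f: "a \<in> carrier R" "poly_fun R d f'" "\<And>x. x \<in> carrier R \<Longrightarrow> f x = a \<oplus> x \<otimes> f' x"
    using Suc.prems(1) by auto
  have "poly_fun R (Suc d + e) (\<lambda>x. a \<otimes> g x)"
    by (rule poly_fun_mono[OF poly_fun_smult[OF f(1) Suc.prems(2)]]) simp
  moreover have "poly_fun R (Suc d + e) (\<lambda>x. \<zero> \<oplus> x \<otimes> (f' x \<otimes> g x))"
    using Suc.IH[OF f(2) Suc.prems(2)] by auto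
  ultimately have "poly_fun R (Suc d + e) (\<lambda>x. a \<otimes> g x \<oplus> (\<zero> \<oplus> x \<otimes> (f' x \<otimes> g x)))"
    by (rule poly_fun_add)
  moreover have "f x \<otimes> g x = a \<otimes> g x \<oplus> (\<zero> \<oplus> x \<otimes> (f' x \<otimes> g x))" if x: "x \<in> carrier R" for x
  proof -
    have "f' x \<in> carrier R" "g x \<in> carrier R" using f x Suc.prems poly_fun_closed by auto
    then show ?thesis using x f(1) f(3)[OF x] by algebra
  qed
  ultimately show ?case by (rule poly_fun_cong)
qed

lemma poly_fun_finsum:
  "finite A \<Longrightarrow> (\<And>i. i \<in> A \<Longrightarrow> poly_fun R d (f i)) \<Longrightarrow> poly_fun R d (\<lambda>x. \<Oplus>i\<in>A. f i x)"
proof (induction A rule: finite_induct)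
  case empty
  then show ?case by (simp add: poly_fun_const)
next
  case (insert i A)
  have "poly_fun R d (\<lambda>x. f i x \<oplus> (\<Oplus>i\<in>A. f i x))"
    using insert by (intro poly_fun_add) auto
  then show ?case
  proof (rule poly_fun_cong)
    fix x assume x: "x \<in> carrier R"
    have "f j x \<in> carrier R" if "j \<in> insert i A" for j
      using insert.prems[OF that] x by (rule poly_fun_closed)
    then show "(\<Oplus>j\<in>insert i A. f j x) = f i x \<oplus> (\<Oplus>j\<in>A. f j x)"
      using insert.hyps by (intro finsum_insert) auto
  qed
qed

lemma minus_eq_zero_iff:
  assumes "x \<in> carrier R" "a \<in> carrier R"
  shows "x \<ominus> a = \<zero> \<longleftrightarrow> x = a"
proof
  assume "x \<ominus> a = \<zero>"
  moreover have "x = (x \<ominus> a) \<oplus> a" using assms by algebra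
  ultimately show "x = a" using assms by simp
next
  assume "x = a"
  then show "x \<ominus> a = \<zero>" using assms by algebra
qed

text \<open>The product of the factors x - a over \<open>A\<close>; since there are no zero
  divisors, it has no other roots. It serves both as the mask and as the numerator of the Lagrange
  polynomials.\<close>

lemma poly_fun_vanishing:
  assumes "finite A" "A \<subseteq> carrier R"
  shows "\<exists>w. poly_fun R (card A) w \<and> (\<forall>x\<in>carrier R. w x = \<zero> \<longleftrightarrow> x \<in> A)"
  using assms
proof (induction A rule: finite_induct)
  case empty
  then show ?case using poly_fun_const[OF one_closed, of 0] by (intro exI[of _ "\<lambda>x. \<one>"]) auto
next
  case (insert a A)
  then obtain w where w: "poly_fun R (card A) w" "\<And>x. x \<in> carrier R \<Longrightarrow> w x = \<zero> \<longleftrightarrow> x \<in> A"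
    by auto
  have a: "a \<in> carrier R" using insert by auto
  have "poly_fun R (Suc 0) (\<lambda>x. x \<ominus> a)"
    unfolding poly_fun.simps
    by (rule bexI[of _ "\<ominus> a"], rule exI[of _ "\<lambda>x. \<one>"])
      (use a in \<open>auto simp: minus_eq a_comm\<close>)
  from poly_fun_mult[OF this w(1)] have "poly_fun R (card (insert a A)) (\<lambda>x. (x \<ominus> a) \<otimes> w x)"
    using insert by simp
  moreover have "(x \<ominus> a) \<otimes> w x = \<zero> \<longleftrightarrow> x \<in> insert a A" if x: "x \<in> carrier R" for x
  proof -
    have "x \<ominus> a = \<zero> \<longleftrightarrow> x = a"
      using x a by (rule minus_eq_zero_iff)
    then show ?thesis
      using x a w(2)[OF x] poly_fun_closed[OF w(1) x] by (simp add: integral_iff)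
  qed
  ultimately show ?case by blast
qed

text \<open>The polynomial vanishing at all other nodes, divided by its nonzero value at
  \<open>y r\<close>.\<close>

lemma poly_fun_lagrange:
  assumes "inj_on y {..<n}" "y ` {..<n} \<subseteq> carrier R" "r < n"
  shows "\<exists>l. poly_fun R (n - 1) l \<and> (\<forall>r'<n. l (y r') = (if r' = r then \<one> else \<zero>))"
proof -
  let ?A = "y ` ({..<n} - {r})"
  have "card ?A = n - 1"
    using assms by (subst card_image) (auto intro: inj_on_subset)
  moreover have "finite ?A" "?A \<subseteq> carrier R" using assms by auto
  ultimately obtain w where w: "poly_fun R (n - 1) w"
    "\<And>x. x \<in> carrier R \<Longrightarrow> w x = \<zero> \<longleftrightarrow> x \<in> ?A"
    using poly_fun_vanishing[of ?A] by auto
  have yr: "y r \<in> carrier R" "y r \<notin> ?A" using assms by (auto simp: inj_on_def)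
  then have u: "w (y r) \<in> Units R"
    using w poly_fun_closed[OF w(1)] field_Units by auto
  have "poly_fun R (n - 1) (\<lambda>x. inv (w (y r)) \<otimes> w x)"
    using u w by (intro poly_fun_smult) auto
  moreover have "inv (w (y r)) \<otimes> w (y r') = (if r' = r then \<one> else \<zero>)" if "r' < n" for r'
  proof (cases "r' = r")
    case False
    then have "w (y r') = \<zero>" using w(2)[of "y r'"] assms that by auto
    then show ?thesis using False u by simp
  qed (use u in simp)
  ultimately show ?thesis by (intro exI conjI) auto
qed

lemma poly_fun_divided_difference:
  "poly_fun R (Suc d) h \<Longrightarrow> z \<in> carrier R \<Longrightarrow>
    \<exists>g. poly_fun R d g \<and> (\<forall>x\<in>carrier R. h x = h z \<oplus> (x \<ominus> z) \<otimes> g x)"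
proof (induction d arbitrary: h)
  case 0
  then obtain a g b where "a \<in> carrier R" "b \<in> carrier R" 
    and *: "\<forall>x\<in>carrier R. g x = b" "\<forall>x\<in>carrier R. h x = a \<oplus> x \<otimes> g x" by auto
  then have "h x = h z \<oplus> (x \<ominus> z) \<otimes> b" if "x \<in> carrier R" for x
  proof -
    have "h x = a \<oplus> x \<otimes> b" "h z = a \<oplus> z \<otimes> b" using * that 0(2) by auto
    then show ?thesis using \<open>a \<in> _\<close> \<open>b \<in> _\<close> that 0(2) by algebra
  qed
  then show ?case using poly_fun_const[OF \<open>b \<in> carrier R\<close>] by blast
next
  case (Suc d)
  obtain a k where k: "a \<in> carrier R" "poly_fun R (Suc d) k"
    and h: "\<And>x. x \<in> carrier R \<Longrightarrow> h x = a \<oplus> x \<otimes> k x"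
    using Suc.prems(1) unfolding poly_fun.simps(2)[of R "Suc d"] by blast
  obtain g where g: "poly_fun R d g" "\<And>x. x \<in> carrier R \<Longrightarrow> k x = k z \<oplus> (x \<ominus> z) \<otimes> g x"
    using Suc.IH[OF k(2) Suc.prems(2)] by blast
  \<comment> \<open>The quotient comes from x k(x) - z k(z) = (x - z) k(x) + z (k(x) - k(z)), whose
    last difference is (x - z) g(x).\<close>
  have "poly_fun R (Suc d) (\<lambda>x. k x \<oplus> z \<otimes> g x)"
    by (rule poly_fun_add[OF k(2) poly_fun_smult[OF Suc.prems(2) poly_fun_Suc[OF g(1)]]])
  moreover have "h x = h z \<oplus> (x \<ominus> z) \<otimes> (k x \<oplus> z \<otimes> g x)" if x: "x \<in> carrier R" for x
  proof -
    have c: "g x \<in> carrier R" "k z \<in> carrier R" using x Suc.prems g k poly_fun_closed by blast+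
    show ?thesis
      unfolding h[OF x] h[OF Suc.prems(2)] g(2)[OF x] using c x Suc.prems(2) k(1) by algebra
  qed
  ultimately show ?case by blast
qed

text \<open>By induction on the number of nodes, passing from \<open>h\<close> to its divided difference at one node;
  this avoids counting roots of polynomials.\<close>

lemma poly_fun_interpolation:
  assumes "finite S" "card S = Suc d" "inj_on z S" "z ` S \<subseteq> carrier R" "y \<in> carrier R"
  shows "\<exists>c. (\<forall>i. c i \<in> carrier R) \<and> (\<forall>h. poly_fun R d h \<longrightarrow> h y = (\<Oplus>i\<in>S. c i \<otimes> h (z i)))"
  using assms(2,1,3,4)
proof (induction d arbitrary: S)
  case 0
  then obtain i where S: "S = {i}" by (metis One_nat_def card_1_singletonE)
  then have zi: "z i \<in> carrier R" using 0 by simp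
  show ?case
    by (rule exI[of _ "\<lambda>i. \<one>"]) (use zi assms(5) in \<open>auto simp: S\<close>)
next
  case (Suc d)
  obtain i0 T where S: "S = insert i0 T" "i0 \<notin> T" "card T = Suc d" 
    using Suc.prems(1) by (metis card_Suc_eq)
  have T: "finite T" "inj_on z T" "z ` T \<subseteq> carrier R" and z0: "z i0 \<in> carrier R"
    using Suc.prems S by auto
  have zT: "z i \<in> carrier R" "z i \<noteq> z i0" if "i \<in> T" for i
    using that T S Suc.prems(3) by (auto simp: inj_on_def)
  obtain c where c: "\<And>i. c i \<in> carrier R"
    "\<And>h. poly_fun R d h \<Longrightarrow> h y = (\<Oplus>i\<in>T. c i \<otimes> h (z i))"
    using Suc.IH[OF S(3) T] by blast
  \<comment> \<open>Insert g(z_i) = (h(z_i) - h(z_i0)) / (z_i - z_i0) into h(y) = h(z_i0) + (y -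
    z_i0) g(y), with g(y) interpolated on \<open>T\<close>: then \<open>e i\<close> is the
    coefficient of h(z_i), and h(z_i0) keeps one minus their sum.\<close>
  define e where "e i = (if i \<in> T then (y \<ominus> z i0) \<otimes> (c i \<otimes> inv (z i \<ominus> z i0)) else \<zero>)" for i
  have u: "z i \<ominus> z i0 \<in> Units R" if "i \<in> T" for i
    using zT[OF that] z0 minus_eq_zero_iff[of "z i" "z i0"] by (simp add: field_Units)
  have e: "e i \<in> carrier R" for i
    using u c(1) z0 assms(5) by (auto simp: e_def)
  have E: "(\<Oplus>i\<in>T. e i) \<in> carrier R" using e by (intro finsum_closed) auto
  define c' where "c' = e(i0 := \<one> \<ominus> (\<Oplus>i\<in>T. e i))"
  have c': "c' i \<in> carrier R" for i using e E by (auto simp: c'_def)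
  have "h y = (\<Oplus>i\<in>S. c' i \<otimes> h (z i))" if h: "poly_fun R (Suc d) h" for h
  proof -
    obtain g where g: "poly_fun R d g" "\<And>x. x \<in> carrier R \<Longrightarrow> h x = h (z i0) \<oplus> (x \<ominus> z i0) \<otimes> g x"
      using poly_fun_divided_difference[OF h z0] by blast
    have hc: "h x \<in> carrier R" "g x \<in> carrier R" if "x \<in> carrier R" for x
      using that h g poly_fun_closed by blast+
    \<comment> \<open>The factor V U is kept together so that it can be replaced by one when V is
      the inverse of U.\<close>
    have alg: "Y \<otimes> (C \<otimes> V) \<otimes> (H \<oplus> U \<otimes> G) \<oplus> Y \<otimes> (C \<otimes> V) \<otimes> (\<ominus> H) = Y \<otimes> (C \<otimes> ((V \<otimes> U) \<otimes> G))"
      if "Y \<in> carrier R" "C \<in> carrier R" "V \<in> carrier R" "H \<in> carrier R" "U \<in> carrier R" "G \<in> carrier R"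
      for Y C V H U G
      using that by algebra
    have eq: "(y \<ominus> z i0) \<otimes> (c i \<otimes> g (z i)) = e i \<otimes> h (z i) \<oplus> e i \<otimes> (\<ominus> h (z i0))" if i: "i \<in> T" for i
    proof -
      let ?u = "z i \<ominus> z i0"
      have cl: "h (z i0) \<in> carrier R" "g (z i) \<in> carrier R" "?u \<in> carrier R" "inv ?u \<in> carrier R"
        "inv ?u \<otimes> ?u = \<one>" "y \<ominus> z i0 \<in> carrier R" "c i \<in> carrier R"
        using hc z0 zT[OF i] u[OF i] c(1) assms(5) by auto
      have "e i \<otimes> h (z i) \<oplus> e i \<otimes> (\<ominus> h (z i0)) =
        (y \<ominus> z i0) \<otimes> (c i \<otimes> inv ?u) \<otimes> (h (z i0) \<oplus> ?u \<otimes> g (z i)) \<oplus> (y \<ominus> z i0) \<otimes> (c i \<otimes> inv ?u) \<otimes> (\<ominus> h (z i0))"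
        using g(2)[OF zT(1)[OF i]] i by (simp add: e_def)
      also have "\<dots> = (y \<ominus> z i0) \<otimes> (c i \<otimes> ((inv ?u \<otimes> ?u) \<otimes> g (z i)))"
        by (rule alg) (use cl in auto)
      also have "\<dots> = (y \<ominus> z i0) \<otimes> (c i \<otimes> g (z i))" using cl by simp
      finally show ?thesis by simp
    qed
    have cl: "(\<lambda>i. e i \<otimes> h (z i)) \<in> T \<rightarrow> carrier R" "(\<lambda>i. e i \<otimes> (\<ominus> h (z i0))) \<in> T \<rightarrow> carrier R"
      using e hc zT z0 by auto
    have "(y \<ominus> z i0) \<otimes> g y = (\<Oplus>i\<in>T. (y \<ominus> z i0) \<otimes> (c i \<otimes> g (z i)))"
      unfolding c(2)[OF g(1)] using T c(1) z0 zT hc assms(5) by (intro finsum_rdistr) auto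
    also have "\<dots> = (\<Oplus>i\<in>T. e i \<otimes> h (z i) \<oplus> e i \<otimes> (\<ominus> h (z i0)))"
      using eq cl by (intro finsum_cong') (auto simp: Pi_iff)
    also have "\<dots> = (\<Oplus>i\<in>T. e i \<otimes> h (z i)) \<oplus> (\<Oplus>i\<in>T. e i) \<otimes> (\<ominus> h (z i0))"
      using cl e hc z0 T by (subst finsum_addf) (auto simp: finsum_ldistr)
    finally have *: "(y \<ominus> z i0) \<otimes> g y = (\<Oplus>i\<in>T. e i \<otimes> h (z i)) \<oplus> (\<Oplus>i\<in>T. e i) \<otimes> (\<ominus> h (z i0))" .
    have "(\<Oplus>i\<in>S. c' i \<otimes> h (z i)) = c' i0 \<otimes> h (z i0) \<oplus> (\<Oplus>i\<in>T. c' i \<otimes> h (z i))"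
      unfolding S(1) using S(2) T c' hc zT z0 by (intro finsum_insert) auto
    also have "(\<Oplus>i\<in>T. c' i \<otimes> h (z i)) = (\<Oplus>i\<in>T. e i \<otimes> h (z i))"
      using cl S(2) by (intro finsum_cong') (auto simp: c'_def)
    also have "c' i0 \<otimes> h (z i0) \<oplus> (\<Oplus>i\<in>T. e i \<otimes> h (z i)) =
        h (z i0) \<oplus> ((\<Oplus>i\<in>T. e i \<otimes> h (z i)) \<oplus> (\<Oplus>i\<in>T. e i) \<otimes> (\<ominus> h (z i0)))"
    proof -
      have "(\<Oplus>i\<in>T. e i \<otimes> h (z i)) \<in> carrier R" "h (z i0) \<in> carrier R"
        using cl hc z0 by (auto intro!: finsum_closed)
      moreover have "(\<one> \<ominus> E) \<otimes> H \<oplus> G = H \<oplus> (G \<oplus> E \<otimes> (\<ominus> H))"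
        if "E \<in> carrier R" "H \<in> carrier R" "G \<in> carrier R" for E H G
        using that by (simp add: minus_eq l_distr l_minus r_minus a_ac)
      ultimately show ?thesis using E by (simp add: c'_def)
    qed
    also have "\<dots> = h y" using g(2)[OF assms(5)] * by simp
    finally show ?thesis ..
  qed
  with c' show ?case by blast
qed

end

section \<open>Rank decompositions of the matrix multiplication tensor\<close>

context field begin

section \<open>Rearranging finite sums over a field\<close>

lemma finsum_swap:
  assumes "finite A" "finite B" "\<And>a b. a \<in> A \<Longrightarrow> b \<in> B \<Longrightarrow> f a b \<in> carrier R"
  shows "(\<Oplus>a\<in>A. \<Oplus>b\<in>B. f a b) = (\<Oplus>b\<in>B. \<Oplus>a\<in>A. f a b)"
  using assms(1,3)
proof (induction A rule: finite_induct)
  case (insert a A)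
  have c: "(\<lambda>b. f a b) \<in> B \<rightarrow> carrier R" "(\<lambda>b. \<Oplus>a\<in>A. f a b) \<in> B \<rightarrow> carrier R"
    using insert.prems by (auto intro!: finsum_closed)
  have "(\<Oplus>a\<in>insert a A. \<Oplus>b\<in>B. f a b) = (\<Oplus>b\<in>B. f a b) \<oplus> (\<Oplus>a\<in>A. \<Oplus>b\<in>B. f a b)"
    using insert by (intro finsum_insert) (auto intro!: finsum_closed)
  also have "\<dots> = (\<Oplus>b\<in>B. f a b) \<oplus> (\<Oplus>b\<in>B. \<Oplus>a\<in>A. f a b)"
    using insert by simp
  also have "\<dots> = (\<Oplus>b\<in>B. f a b \<oplus> (\<Oplus>a\<in>A. f a b))"
    using finsum_addf[OF c] by simp
  also have "\<dots> = (\<Oplus>b\<in>B. \<Oplus>a\<in>insert a A. f a b)"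
    using insert by (intro finsum_cong') (auto intro!: finsum_closed finsum_insert[symmetric])
  finally show ?case .
qed simp

lemma finsum_supported_on_image:
  assumes "finite B" "inj_on h A" "h ` A \<subseteq> B"
    and "\<And>b. b \<in> B \<Longrightarrow> b \<notin> h ` A \<Longrightarrow> f b = \<zero>" "\<And>a. a \<in> A \<Longrightarrow> f (h a) = g a"
    and "\<And>a. a \<in> A \<Longrightarrow> g a \<in> carrier R"
  shows "finsum R f B = finsum R g A"
proof -
  have f: "f \<in> B \<rightarrow> carrier R"
  proof
    fix b assume "b \<in> B"
    then show "f b \<in> carrier R" using assms(4)[of b] assms(5,6) by (cases "b \<in> h ` A") auto
  qed
  have "finsum R f B = finsum R f (h ` A)"
    by (rule add.finprod_mono_neutral_cong_left[symmetric]) (use assms f in auto)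
  also have "\<dots> = finsum R (\<lambda>a. f (h a)) A"
    using f assms(2,3) by (intro finsum_reindex) auto
  also have "\<dots> = finsum R g A"
    using assms(5,6) by (intro finsum_cong') auto
  finally show ?thesis .
qed

text \<open>Splits a row index into the number \<open>l\<close> of its block and the position
  \<open>h\<close> inside the block.\<close>

lemma finsum_lessThan_mult:
  assumes "\<And>i. f i \<in> carrier R"
  shows "(\<Oplus>i\<in>{..<p * q}. f i) = (\<Oplus>l\<in>{..<p::nat}. \<Oplus>h\<in>{..<q}. f (l * q + h))"
proof (induction p)
  case (Suc p)
  have "{..<Suc p * q} = {..<p * q} \<union> (\<lambda>h. p * q + h) ` {..<q}"
  proof -
    have "x \<in> (\<lambda>h. p * q + h) ` {..<q}" if "x < Suc p * q" "\<not> x < p * q" for x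
      using that by (intro image_eqI[of _ _ "x - p * q"]) auto
    then show ?thesis by auto
  qed
  moreover have "{..<p * q} \<inter> (\<lambda>h. p * q + h) ` {..<q} = {}" by auto
  ultimately have "(\<Oplus>i\<in>{..<Suc p * q}. f i) = (\<Oplus>i\<in>{..<p * q}. f i) \<oplus> (\<Oplus>i\<in>(\<lambda>h. p * q + h) ` {..<q}. f i)"
    using assms by (simp add: finsum_Un_disjoint)
  also have "(\<Oplus>i\<in>(\<lambda>h. p * q + h) ` {..<q}. f i) = (\<Oplus>h\<in>{..<q}. f (p * q + h))"
    using assms by (intro finsum_reindex) (auto simp: inj_on_def)
  also have "(\<Oplus>i\<in>{..<p * q}. f i) \<oplus> \<dots> = (\<Oplus>h\<in>{..<q}. f (p * q + h)) \<oplus> (\<Oplus>l\<in>{..<p}. \<Oplus>h\<in>{..<q}. f (l * q + h))"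
    unfolding Suc by (rule a_comm) (use assms in \<open>auto intro!: finsum_closed\<close>)
  also have "\<dots> = (\<Oplus>l\<in>{..<Suc p}. \<Oplus>h\<in>{..<q}. f (l * q + h))"
    unfolding lessThan_Suc using assms by (intro finsum_insert[symmetric]) (auto intro!: finsum_closed)
  finally show ?case .
qed simp

lemma finsum_mult_finsum:
  assumes "finite I" "finite J" "\<And>a. a \<in> I \<Longrightarrow> f a \<in> carrier R" "\<And>b. b \<in> J \<Longrightarrow> g b \<in> carrier R"
  shows "(\<Oplus>a\<in>I. f a) \<otimes> (\<Oplus>b\<in>J. g b) = (\<Oplus>a\<in>I. \<Oplus>b\<in>J. f a \<otimes> g b)"
proof -
  have "(\<Oplus>a\<in>I. f a) \<otimes> (\<Oplus>b\<in>J. g b) = (\<Oplus>a\<in>I. f a \<otimes> (\<Oplus>b\<in>J. g b))"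
    using assms by (intro finsum_ldistr) (auto intro!: finsum_closed)
  also have "\<dots> = (\<Oplus>a\<in>I. \<Oplus>b\<in>J. f a \<otimes> g b)"
    using assms by (intro finsum_cong' finsum_rdistr) (auto intro!: finsum_closed)
  finally show ?thesis .
qed

text \<open>Distributing and exchanging sums turns the coefficient of each product X_a Z_b into an
  entry of the tensor, to which a rank decomposition applies.\<close>

lemma bilinear_expansion:
  assumes fin: "finite T" "finite I" "finite J"
    and c: "\<And>r. g r \<in> carrier R" "\<And>r a. \<alpha> r a \<in> carrier R" "\<And>r b. \<beta> r b \<in> carrier R"
      "\<And>a. X a \<in> carrier R" "\<And>b. Z b \<in> carrier R"
  shows "(\<Oplus>r\<in>T. g r \<otimes> ((\<Oplus>a\<in>I. \<alpha> r a \<otimes> X a) \<otimes> (\<Oplus>b\<in>J. \<beta> r b \<otimes> Z b)))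
    = (\<Oplus>a\<in>I. \<Oplus>b\<in>J. (\<Oplus>r\<in>T. \<alpha> r a \<otimes> \<beta> r b \<otimes> g r) \<otimes> (X a \<otimes> Z b))"
proof -
  have "g r \<otimes> ((\<Oplus>a\<in>I. \<alpha> r a \<otimes> X a) \<otimes> (\<Oplus>b\<in>J. \<beta> r b \<otimes> Z b))
      = (\<Oplus>a\<in>I. \<Oplus>b\<in>J. \<alpha> r a \<otimes> \<beta> r b \<otimes> g r \<otimes> (X a \<otimes> Z b))" for r
  proof -
    have alg: "g' \<otimes> (a' \<otimes> x \<otimes> (b' \<otimes> z)) = a' \<otimes> b' \<otimes> g' \<otimes> (x \<otimes> z)"
      if "g' \<in> carrier R" "a' \<in> carrier R" "x \<in> carrier R" "b' \<in> carrier R" "z \<in> carrier R"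
      for g' a' x b' z
      using that by algebra
    have "g r \<otimes> ((\<Oplus>a\<in>I. \<alpha> r a \<otimes> X a) \<otimes> (\<Oplus>b\<in>J. \<beta> r b \<otimes> Z b))
      = g r \<otimes> (\<Oplus>a\<in>I. \<Oplus>b\<in>J. \<alpha> r a \<otimes> X a \<otimes> (\<beta> r b \<otimes> Z b))"
      using fin c by (subst finsum_mult_finsum) auto
    also have "\<dots> = (\<Oplus>a\<in>I. \<Oplus>b\<in>J. g r \<otimes> (\<alpha> r a \<otimes> X a \<otimes> (\<beta> r b \<otimes> Z b)))"
      using fin c by (simp add: finsum_rdistr Pi_def)
    finally show ?thesis using alg c by simp
  qed
  then have "(\<Oplus>r\<in>T. g r \<otimes> ((\<Oplus>a\<in>I. \<alpha> r a \<otimes> X a) \<otimes> (\<Oplus>b\<in>J. \<beta> r b \<otimes> Z b)))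
      = (\<Oplus>r\<in>T. \<Oplus>a\<in>I. \<Oplus>b\<in>J. \<alpha> r a \<otimes> \<beta> r b \<otimes> g r \<otimes> (X a \<otimes> Z b))"
    by simp
  also have "\<dots> = (\<Oplus>a\<in>I. \<Oplus>r\<in>T. \<Oplus>b\<in>J. \<alpha> r a \<otimes> \<beta> r b \<otimes> g r \<otimes> (X a \<otimes> Z b))"
    using fin c by (intro finsum_swap) (auto intro!: finsum_closed)
  also have "\<dots> = (\<Oplus>a\<in>I. \<Oplus>b\<in>J. \<Oplus>r\<in>T. \<alpha> r a \<otimes> \<beta> r b \<otimes> g r \<otimes> (X a \<otimes> Z b))"
    using fin c by (intro finsum_cong' finsum_swap) (auto intro!: finsum_closed)
  also have "\<dots> = (\<Oplus>a\<in>I. \<Oplus>b\<in>J. (\<Oplus>r\<in>T. \<alpha> r a \<otimes> \<beta> r b \<otimes> g r) \<otimes> (X a \<otimes> Z b))"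
    using fin c by (intro finsum_cong' finsum_ldistr[symmetric]) (auto intro!: finsum_closed)
  finally show ?thesis .
qed

end

section \<open>Existence of decompositions and bounds on the rank\<close>

definition mm_decomposition ::
  "('c,'e) ring_scheme \<Rightarrow> nat \<Rightarrow> nat \<Rightarrow> nat \<Rightarrow> nat \<Rightarrow> (nat \<Rightarrow> nat \<Rightarrow> nat \<Rightarrow> 'c)
    \<Rightarrow> (nat \<Rightarrow> nat \<Rightarrow> nat \<Rightarrow> 'c) \<Rightarrow> (nat \<Rightarrow> nat \<Rightarrow> nat \<Rightarrow> 'c) \<Rightarrow> bool" where
  "mm_decomposition F p m n R \<alpha> \<beta> \<gamma> \<longleftrightarrow>
      (\<forall>r j l. \<alpha> r j l \<in> carrier F) \<and> (\<forall>r l k. \<beta> r l k \<in> carrier F) \<and>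
      (\<forall>r j k. \<gamma> r j k \<in> carrier F) \<and>
      (\<forall>j l l' k j' k'. j < m \<longrightarrow> l < p \<longrightarrow> l' < p \<longrightarrow> k < n \<longrightarrow> j' < m \<longrightarrow> k' < n \<longrightarrow>
         (if j = j' \<and> l = l' \<and> k = k' then \<one>\<^bsub>F\<^esub> else \<zero>\<^bsub>F\<^esub>) =
         (\<Oplus>\<^bsub>F\<^esub> r\<in>{..<R}. \<alpha> r j l \<otimes>\<^bsub>F\<^esub> \<beta> r l' k \<otimes>\<^bsub>F\<^esub> \<gamma> r j' k'))"

lemma mm_rank_eq_Least: "mm_rank F p m n = (LEAST R. \<exists>\<alpha> \<beta> \<gamma>. mm_decomposition F p m n R \<alpha> \<beta> \<gamma>)"
  unfolding mm_rank_def mm_decomposition_def ..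

context field begin

text \<open>Schoolbook multiplication, with one term for each triple (l, j, k). It makes the minimum
  in \<open>mm_rank\<close> attained and bounds it independently of the field.\<close>

lemma mm_decomposition_trivial: "\<exists>\<alpha> \<beta> \<gamma>. mm_decomposition R p m n (p * m * n) \<alpha> \<beta> \<gamma>"
proof -
  let ?T = "{..<p} \<times> {..<m} \<times> {..<n}"
  have "card ?T = p * m * n" by (simp add: card_cartesian_product)
  then obtain e where e: "bij_betw e {..<p * m * n} ?T"
    using ex_bij_betw_nat_finite[of ?T] by (auto simp: atLeast0LessThan mult.assoc)
  define \<alpha> where "\<alpha> r j l = (if l = fst (e r) \<and> j = fst (snd (e r)) then \<one> else \<zero>)" for r j l
  define \<beta> where "\<beta> r l k = (if l = fst (e r) \<and> k = snd (snd (e r)) then \<one> else \<zero>)" for r l k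
  define \<gamma> where "\<gamma> r j k = (if j = fst (snd (e r)) \<and> k = snd (snd (e r)) then \<one> else \<zero>)" for r j k
  have "(\<Oplus>r\<in>{..<p * m * n}. \<alpha> r j l \<otimes> \<beta> r l' k \<otimes> \<gamma> r j' k')
      = (if j = j' \<and> l = l' \<and> k = k' then \<one> else \<zero>)"
    if b: "j < m" "l < p" "l' < p" "k < n" "j' < m" "k' < n" for j l l' k j' k'
  proof -
    have "(l, j, k) \<in> e ` {..<p * m * n}"
      using b bij_betw_imp_surj_on[OF e] by simp
    then obtain r0 where r0: "r0 < p * m * n" "e r0 = (l, j, k)"
      by (metis imageE lessThan_iff)
    \<comment> \<open>The factors from \<alpha> and \<beta> force \<open>e r = (l, j, k)\<close> and
      l' = l, and the one from \<gamma> then forces j' = j and k' = k; injectivity of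
      \<open>e\<close> leaves only the term \<open>r0\<close>.\<close>
    have "\<alpha> r j l \<otimes> \<beta> r l' k \<otimes> \<gamma> r j' k'
        = (if r0 = r then (if j = j' \<and> l = l' \<and> k = k' then \<one> else \<zero>) else \<zero>)"
      if r: "r < p * m * n" for r
    proof -
      have iff: "r0 = r \<longleftrightarrow> e r = (l, j, k)"
        using inj_on_eq_iff[OF bij_betw_imp_inj_on[OF e], of r0 r] r r0 by auto
      obtain a b c where abc: "e r = (a, b, c)" by (cases "e r")
      show ?thesis
        unfolding iff abc \<alpha>_def \<beta>_def \<gamma>_def fst_conv snd_conv by auto
    qed
    then have "(\<Oplus>r\<in>{..<p * m * n}. \<alpha> r j l \<otimes> \<beta> r l' k \<otimes> \<gamma> r j' k')
        = (\<Oplus>r\<in>{..<p * m * n}. if r0 = r then (if j = j' \<and> l = l' \<and> k = k' then \<one> else \<zero>) else \<zero>)"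
      by (intro finsum_cong') auto
    also have "\<dots> = (if j = j' \<and> l = l' \<and> k = k' then \<one> else \<zero>)"
      using r0 by (intro finsum_singleton) auto
    finally show ?thesis .
  qed
  then have "mm_decomposition R p m n (p * m * n) \<alpha> \<beta> \<gamma>"
    unfolding mm_decomposition_def by (auto simp: \<alpha>_def \<beta>_def \<gamma>_def)
  then show ?thesis by (intro exI)
qed

lemma mm_rank_le: "mm_rank R p m n \<le> p * m * n"
  unfolding mm_rank_eq_Least by (rule Least_le) (rule mm_decomposition_trivial)

lemma mm_rank_decomposition: "\<exists>\<alpha> \<beta> \<gamma>. mm_decomposition R p m n (mm_rank R p m n) \<alpha> \<beta> \<gamma>"
  unfolding mm_rank_eq_Least by (rule LeastI_ex) (use mm_decomposition_trivial in blast)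

text \<open>With no terms the sum is zero, but the tensor has an entry one. Positivity makes the
  degree \<rho> - 1 of the encoding an honest subtraction later.\<close>

lemma mm_rank_pos:
  assumes "p \<ge> 1" "m \<ge> 1" "n \<ge> 1"
  shows "mm_rank R p m n \<ge> 1"
proof (rule ccontr)
  assume "\<not> mm_rank R p m n \<ge> 1"
  then have "mm_rank R p m n = 0" by simp
  then obtain \<alpha> \<beta> \<gamma> where "mm_decomposition R p m n 0 \<alpha> \<beta> \<gamma>"
    using mm_rank_decomposition[of p m n] by auto
  then have "\<forall>j l l' k j' k'. j < m \<longrightarrow> l < p \<longrightarrow> l' < p \<longrightarrow> k < n \<longrightarrow> j' < m \<longrightarrow> k' < n \<longrightarrow>
         (if j = j' \<and> l = l' \<and> k = k' then \<one> else \<zero>) = \<zero>"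
    by (simp add: mm_decomposition_def)
  from this[rule_format, of 0 0 0 0 0 0] show False using assms by simp
qed

text \<open>After \<open>bilinear_expansion\<close> the coefficients are Kronecker deltas, which
  select a = (l, j) and b = (l, k). Pairs list the block row first, whereas \<alpha> takes the
  column index \<open>j\<close> before \<open>l\<close>.\<close>

lemma mm_decomposition_product:
  assumes dec: "mm_decomposition R p m n \<rho> \<alpha> \<beta> \<gamma>" and "j < m" "k < n"
    and X: "\<And>a. X a \<in> carrier R" and Z: "\<And>b. Z b \<in> carrier R"
  shows "(\<Oplus>r\<in>{..<\<rho>}. \<gamma> r j k \<otimes> ((\<Oplus>a\<in>{..<p} \<times> {..<m}. \<alpha> r (snd a) (fst a) \<otimes> X a)
              \<otimes> (\<Oplus>b\<in>{..<p} \<times> {..<n}. \<beta> r (fst b) (snd b) \<otimes> Z b)))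
    = (\<Oplus>l\<in>{..<p}. X (l, j) \<otimes> Z (l, k))"
proof -
  let ?I = "{..<p} \<times> {..<m}" and ?J = "{..<p} \<times> {..<n}"
  have c: "\<And>r j l. \<alpha> r j l \<in> carrier R" "\<And>r l k. \<beta> r l k \<in> carrier R" "\<And>r j k. \<gamma> r j k \<in> carrier R"
    using dec by (auto simp: mm_decomposition_def)
  have "(\<Oplus>r\<in>{..<\<rho>}. \<gamma> r j k \<otimes> ((\<Oplus>a\<in>?I. \<alpha> r (snd a) (fst a) \<otimes> X a)
              \<otimes> (\<Oplus>b\<in>?J. \<beta> r (fst b) (snd b) \<otimes> Z b)))
    = (\<Oplus>a\<in>?I. \<Oplus>b\<in>?J. (\<Oplus>r\<in>{..<\<rho>}. \<alpha> r (snd a) (fst a) \<otimes> \<beta> r (fst b) (snd b) \<otimes> \<gamma> r j k) \<otimes> (X a \<otimes> Z b))"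
    by (rule bilinear_expansion) (use c X Z in auto)
  also have "\<dots> = (\<Oplus>a\<in>?I. if snd a = j then X a \<otimes> Z (fst a, k) else \<zero>)"
  proof (intro finsum_cong')
    fix a assume a: "a \<in> ?I"
    have "(\<Oplus>b\<in>?J. (\<Oplus>r\<in>{..<\<rho>}. \<alpha> r (snd a) (fst a) \<otimes> \<beta> r (fst b) (snd b) \<otimes> \<gamma> r j k) \<otimes> (X a \<otimes> Z b))
      = (\<Oplus>b\<in>?J. if (fst a, k) = b then (if snd a = j then X a \<otimes> Z b else \<zero>) else \<zero>)"
    proof (intro finsum_cong')
      fix b assume b: "b \<in> ?J"
      have "(if snd a = j \<and> fst a = fst b \<and> snd b = k then \<one> else \<zero>)
          = (\<Oplus>r\<in>{..<\<rho>}. \<alpha> r (snd a) (fst a) \<otimes> \<beta> r (fst b) (snd b) \<otimes> \<gamma> r j k)"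
      proof -
        have "\<forall>j l l' k j' k'. j < m \<longrightarrow> l < p \<longrightarrow> l' < p \<longrightarrow> k < n \<longrightarrow> j' < m \<longrightarrow> k' < n \<longrightarrow>
          (if j = j' \<and> l = l' \<and> k = k' then \<one> else \<zero>) =
          (\<Oplus>r\<in>{..<\<rho>}. \<alpha> r j l \<otimes> \<beta> r l' k \<otimes> \<gamma> r j' k')"
          using dec unfolding mm_decomposition_def by blast
        from this[rule_format, of "snd a" "fst a" "fst b" "snd b" j k] show ?thesis
          using a b assms(2,3) by auto
      qed
      from this[symmetric] show "(\<Oplus>r\<in>{..<\<rho>}. \<alpha> r (snd a) (fst a) \<otimes> \<beta> r (fst b) (snd b) \<otimes> \<gamma> r j k) \<otimes> (X a \<otimes> Z b)
        = (if (fst a, k) = b then (if snd a = j then X a \<otimes> Z b else \<zero>) else \<zero>)"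
        using X Z by (cases b) auto
    qed (use X Z in auto)
    also have "\<dots> = (if snd a = j then X a \<otimes> Z (fst a, k) else \<zero>)"
      using a assms(3) X Z by (intro finsum_singleton) auto
    finally show "(\<Oplus>b\<in>?J. (\<Oplus>r\<in>{..<\<rho>}. \<alpha> r (snd a) (fst a) \<otimes> \<beta> r (fst b) (snd b) \<otimes> \<gamma> r j k) \<otimes> (X a \<otimes> Z b))
      = (if snd a = j then X a \<otimes> Z (fst a, k) else \<zero>)" .
  qed (use X Z in auto)
  also have "\<dots> = (\<Oplus>l\<in>{..<p}. X (l, j) \<otimes> Z (l, k))"
    by (rule finsum_supported_on_image[where h = "\<lambda>l. (l, j)"])
      (use assms(2) X Z in \<open>auto simp: inj_on_def\<close>)
  finally show ?thesis .
qed

end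

section \<open>Privacy and security\<close>

text \<open>If the query has the same law \<nu> for every request, the draw of \<open>D\<close> can
  be moved to the front, and what follows is the law \<open>V\<close> of the worker's view, free of
  \<open>D\<close>. The coded matrix \<open>g A Ks\<close> must itself be independent of the
  request.\<close>

lemma mutual_information_request_eq_0:
  assumes "M \<ge> 1" and \<nu>: "\<And>D. D < M \<Longrightarrow> map_pmf (q D) \<mu> = \<nu>"
  shows "prob_space.mutual_information (measure_pmf (pm_experiment F p m M s t r L \<mu>)) 2
      (count_space UNIV) (count_space UNIV) (\<lambda>(A, Bs, D, Ks, \<omega>). D)
      (\<lambda>(A, Bs, D, Ks, \<omega>). (q D \<omega>, g A Ks, Bs)) = 0"
proof (rule mutual_information_eq_0_of_pair_pmf)
  define V where "V = do {
     A \<leftarrow> pmf_of_set (mats F s t);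
     Bs \<leftarrow> pmf_of_set (mat_list F M s r);
     Ks \<leftarrow> pmf_of_set (mat_list F L (s div p) (t div m));
     y \<leftarrow> \<nu>;
     return_pmf (y, g A Ks, Bs) }"
  let ?A = "pmf_of_set (mats F s t)" and ?B = "pmf_of_set (mat_list F M s r)"
    and ?D = "pmf_of_set {..<M}" and ?K = "pmf_of_set (mat_list F L (s div p) (t div m))"
  have D: "set_pmf ?D = {..<M}" using assms(1) by (intro set_pmf_of_set) (auto simp: lessThan_empty_iff)
  have "map_pmf (\<lambda>\<omega>. (case \<omega> of (A, Bs, D, Ks, \<omega>) \<Rightarrow> D,
           case \<omega> of (A, Bs, D, Ks, \<omega>) \<Rightarrow> (q D \<omega>, g A Ks, Bs))) (pm_experiment F p m M s t r L \<mu>)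
      = do { A \<leftarrow> ?A; Bs \<leftarrow> ?B; D \<leftarrow> ?D; Ks \<leftarrow> ?K; y \<leftarrow> map_pmf (q D) \<mu>; return_pmf (D, y, g A Ks, Bs) }"
    by (simp add: pm_experiment_def map_bind_pmf bind_map_pmf)
  also have "\<dots> = do { A \<leftarrow> ?A; Bs \<leftarrow> ?B; D \<leftarrow> ?D; Ks \<leftarrow> ?K; y \<leftarrow> \<nu>; return_pmf (D, y, g A Ks, Bs) }"
    using \<nu> D by (intro bind_pmf_cong refl) auto
  also have "\<dots> = do { A \<leftarrow> ?A; D \<leftarrow> ?D; Bs \<leftarrow> ?B; Ks \<leftarrow> ?K; y \<leftarrow> \<nu>; return_pmf (D, y, g A Ks, Bs) }"
    by (subst (2) bind_commute_pmf) (rule refl)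
  also have "\<dots> = do { D \<leftarrow> ?D; A \<leftarrow> ?A; Bs \<leftarrow> ?B; Ks \<leftarrow> ?K; y \<leftarrow> \<nu>; return_pmf (D, y, g A Ks, Bs) }"
    by (rule bind_commute_pmf)
  also have "\<dots> = pair_pmf ?D V"
    by (simp add: pair_pmf_def V_def bind_assoc_pmf bind_return_pmf)
  finally show "map_pmf (\<lambda>\<omega>. (case \<omega> of (A, Bs, D, Ks, \<omega>) \<Rightarrow> D,
           case \<omega> of (A, Bs, D, Ks, \<omega>) \<Rightarrow> (q D \<omega>, g A Ks, Bs))) (pm_experiment F p m M s t r L \<mu>)
      = pair_pmf ?D V" .
qed

text \<open>If the coded matrix has the same law for every fixed \<open>A\<close>, it can be drawn
  first from \<nu>, with \<open>A\<close> drawn independently afterwards.\<close>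

lemma mutual_information_data_eq_0:
  assumes fin: "finite (mats F s t)" and ne: "mats F s t \<noteq> {}"
    and \<nu>: "\<And>A. A \<in> mats F s t \<Longrightarrow> map_pmf (g A) (pmf_of_set (mat_list F L (s div p) (t div m))) = \<nu>"
  shows "prob_space.mutual_information (measure_pmf (pm_experiment F p m M s t r L \<mu>)) 2
      (count_space UNIV) (count_space UNIV) (\<lambda>(A, Bs, D, Ks, \<omega>). g A Ks)
      (\<lambda>(A, Bs, D, Ks, \<omega>). A) = 0"
proof (rule mutual_information_eq_0_of_pair_pmf)
  let ?A = "pmf_of_set (mats F s t)" and ?B = "pmf_of_set (mat_list F M s r)"
    and ?D = "pmf_of_set {..<M}" and ?K = "pmf_of_set (mat_list F L (s div p) (t div m))"
  have A: "set_pmf ?A = mats F s t" using fin ne by (intro set_pmf_of_set)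
  have "map_pmf (\<lambda>\<omega>. (case \<omega> of (A, Bs, D, Ks, \<omega>) \<Rightarrow> g A Ks,
           case \<omega> of (A, Bs, D, Ks, \<omega>) \<Rightarrow> A)) (pm_experiment F p m M s t r L \<mu>)
      = do { A \<leftarrow> ?A; x \<leftarrow> map_pmf (g A) ?K; return_pmf (x, A) }"
    by (simp add: pm_experiment_def map_bind_pmf bind_map_pmf)
  also have "\<dots> = do { A \<leftarrow> ?A; x \<leftarrow> \<nu>; return_pmf (x, A) }"
    using \<nu> A by (intro bind_pmf_cong refl) auto
  also have "\<dots> = do { x \<leftarrow> \<nu>; A \<leftarrow> ?A; return_pmf (x, A) }"
    by (rule bind_commute_pmf)
  also have "\<dots> = pair_pmf \<nu> ?A"
    by (simp add: pair_pmf_def)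
  finally show "map_pmf (\<lambda>\<omega>. (case \<omega> of (A, Bs, D, Ks, \<omega>) \<Rightarrow> g A Ks,
           case \<omega> of (A, Bs, D, Ks, \<omega>) \<Rightarrow> A)) (pm_experiment F p m M s t r L \<mu>)
      = pair_pmf \<nu> ?A" .
qed

text \<open>The private randomness in \<^const>\<open>pm_experiment\<close> is a sequence indexed by naturals, whereas a query
  has coefficients indexed by triples.\<close>

definition encode3 :: "nat \<times> nat \<times> nat \<Rightarrow> nat" where
  "encode3 x = prod_encode (fst x, prod_encode (snd x))"

definition decode3 :: "nat \<Rightarrow> nat \<times> nat \<times> nat" where
  "decode3 e = (fst (prod_decode e), prod_decode (snd (prod_decode e)))"

lemma decode3_encode3 [simp]: "decode3 (encode3 x) = x"
  by (simp add: encode3_def decode3_def)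

context field begin

text \<open>The right side mentions neither \<open>v\<close> nor \<open>c\<close>, so the law of the
  query reveals nothing about the vector it hides. The mask is absorbed by an affine permutation of
  the randomness.\<close>

lemma map_pmf_masked_query:
  assumes "finite (carrier R)" "finite I" "c \<in> carrier R" "c \<noteq> \<zero>" "\<And>x. x \<in> I \<Longrightarrow> v x \<in> carrier R"
  shows "map_pmf (\<lambda>\<omega> x l k. if (x, l, k) \<in> I then v (x, l, k) \<oplus> c \<otimes> \<omega> (encode3 (x, l, k)) else \<zero>)
      (pmf_of_set (supported_funs R (encode3 ` I)))
    = map_pmf (\<lambda>\<omega> x l k. if (x, l, k) \<in> I then \<omega> (encode3 (x, l, k)) else \<zero>)
      (pmf_of_set (supported_funs R (encode3 ` I)))"
proof -
  let ?W = "supported_funs R (encode3 ` I)"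
  \<comment> \<open>The affine map in terms of code numbers, where \<open>decode3\<close> recovers
    the triple that indexes \<open>v\<close>.\<close>
  let ?T = "\<lambda>\<omega> e. if e \<in> encode3 ` I then v (decode3 e) \<oplus> c \<otimes> \<omega> e else \<zero>"
  have "bij_betw ?T ?W ?W"
    by (rule bij_betw_affine) (use assms in auto)
  then have "map_pmf ?T (pmf_of_set ?W) = pmf_of_set ?W"
    using assms by (intro map_pmf_of_set_bij_betw supported_funs_nonempty finite_supported_funs) auto
  then have "map_pmf (\<lambda>\<omega> x l k. if (x, l, k) \<in> I then \<omega> (encode3 (x, l, k)) else \<zero>) (pmf_of_set ?W)
      = map_pmf (\<lambda>\<omega> x l k. if (x, l, k) \<in> I then \<omega> (encode3 (x, l, k)) else \<zero>) (map_pmf ?T (pmf_of_set ?W))"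
    by simp
  also have "\<dots> = map_pmf (\<lambda>\<omega> x l k. if (x, l, k) \<in> I then v (x, l, k) \<oplus> c \<otimes> \<omega> (encode3 (x, l, k)) else \<zero>)
      (pmf_of_set ?W)"
    unfolding map_pmf_comp by (intro arg_cong2[where f = map_pmf] refl ext) auto
  finally show ?thesis ..
qed

text \<open>For fixed \<open>A\<close> the data part is a constant shift and the key part a nonzero
  multiple of a uniform matrix, so the sum is uniform.\<close>

lemma map_pmf_coded_A:
  assumes fin: "finite (carrier R)" and A: "A \<in> mats R s t"
    and ca: "\<And>l j. ca l j \<in> carrier R" and ck: "ck 0 \<in> carrier R" "ck 0 \<noteq> \<zero>"
  shows "map_pmf (coded_A R p m s t 1 ca ck A) (pmf_of_set (mat_list R 1 (s div p) (t div m)))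
    = pmf_of_set (mats R (s div p) (t div m))"
proof -
  let ?v = "\<lambda>i j. \<Oplus>lj\<in>{..<p} \<times> {..<m}. ca (fst lj) (snd lj) \<otimes>
            block R (s div p) (t div m) A (fst lj) (snd lj) i j"
  let ?T = "\<lambda>Ks i j. if i < s div p \<and> j < t div m then ?v i j \<oplus> ck 0 \<otimes> Ks 0 i j else \<zero>"
  have A': "A i j \<in> carrier R" for i j
    using A by (rule mats_closed)
  have v: "?v i j \<in> carrier R" for i j
    using ca A' by (auto intro!: finsum_closed simp: block_def)
  have "map_pmf (coded_A R p m s t 1 ca ck A) (pmf_of_set (mat_list R 1 (s div p) (t div m)))
      = map_pmf ?T (pmf_of_set (mat_list R 1 (s div p) (t div m)))"
  proof (rule map_pmf_cong[OF refl])
    fix Ks assume "Ks \<in> set_pmf (pmf_of_set (mat_list R 1 (s div p) (t div m)))"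
    then have "Ks \<in> mat_list R 1 (s div p) (t div m)"
      using fin by (simp add: set_pmf_of_set finite_mat_list mat_list_nonempty)
    then have K: "Ks 0 i j \<in> carrier R" for i j
      by (rule mat_list_closed)
    have key: "(\<Oplus>u\<in>{..<1}. ck u \<otimes> Ks u i j) = ck 0 \<otimes> Ks 0 i j" for i j
      using K ck by (simp add: lessThan_Suc)
    then show "coded_A R p m s t 1 ca ck A Ks = ?T Ks"
      by (simp only: coded_A_def key)
  qed
  also have "\<dots> = pmf_of_set (mats R (s div p) (t div m))"
    using fin v ck by (intro map_pmf_of_set_bij_betw bij_betw_mats_affine finite_mat_list mat_list_nonempty) auto
  finally show ?thesis .
qed

end

section \<open>Decoding\<close>

context field begin

section \<open>Coded entries as polynomials in the evaluation point\<close>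

lemma poly_fun_smult_right:
  assumes "c \<in> carrier R" "poly_fun R d f"
  shows "poly_fun R d (\<lambda>x. f x \<otimes> c)"
  by (rule poly_fun_cong[OF poly_fun_smult[OF assms]])
    (use assms poly_fun_closed m_comm in auto)

lemma block_closed: "X \<in> mats R a b \<Longrightarrow> block R h w X bi bj i j \<in> carrier R"
  by (simp add: block_def mats_closed)

lemma block_mat_list_closed: "Bs \<in> mat_list R M a b \<Longrightarrow> block R h w (Bs x) bi bj i j \<in> carrier R"
  by (simp add: block_def mat_list_closed)

lemma poly_fun_coded_A:
  assumes A: "A \<in> mats R s t" and Ks: "Ks \<in> mat_list R L a b"
    and CA: "\<And>l j. poly_fun R d (\<lambda>x. CA x l j)" and CK: "\<And>u. u < L \<Longrightarrow> poly_fun R d (\<lambda>x. CK x u)"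
  shows "poly_fun R d (\<lambda>x. coded_A R p m s t L (CA x) (CK x) A Ks h u)"
proof (cases "h < s div p \<and> u < t div m")
  case True
  have "poly_fun R d (\<lambda>x. (\<Oplus>lj\<in>{..<p} \<times> {..<m}. CA x (fst lj) (snd lj) \<otimes>
            block R (s div p) (t div m) A (fst lj) (snd lj) h u)
      \<oplus> (\<Oplus>u'\<in>{..<L}. CK x u' \<otimes> Ks u' h u))"
  proof (rule poly_fun_add)
    show "poly_fun R d (\<lambda>x. \<Oplus>lj\<in>{..<p} \<times> {..<m}. CA x (fst lj) (snd lj) \<otimes>
            block R (s div p) (t div m) A (fst lj) (snd lj) h u)"
      by (rule poly_fun_finsum) (simp, rule poly_fun_smult_right[OF block_closed[OF A] CA])
    show "poly_fun R d (\<lambda>x. \<Oplus>u'\<in>{..<L}. CK x u' \<otimes> Ks u' h u)"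
      by (rule poly_fun_finsum) (simp, rule poly_fun_smult_right[OF mat_list_closed[OF Ks] CK], simp)
  qed
  then show ?thesis using True by (simp add: coded_A_def)
next
  case False
  then show ?thesis
    by (intro poly_fun_cong[OF poly_fun_const[OF zero_closed]]) (auto simp: coded_A_def)
qed

lemma poly_fun_coded_B:
  assumes Bs: "Bs \<in> mat_list R M s r" and CQ: "\<And>x l k. poly_fun R d (\<lambda>z. CQ z x l k)"
  shows "poly_fun R d (\<lambda>z. coded_B R p n M s r (CQ z) Bs h v)"
proof (cases "h < s div p \<and> v < r div n")
  case True
  have "poly_fun R d (\<lambda>z. \<Oplus>x\<in>{..<M} \<times> {..<p} \<times> {..<n}. CQ z (fst x) (fst (snd x)) (snd (snd x)) \<otimes>
            block R (s div p) (r div n) (Bs (fst x)) (fst (snd x)) (snd (snd x)) h v)"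
    by (rule poly_fun_finsum) (simp, rule poly_fun_smult_right[OF block_mat_list_closed[OF Bs] CQ])
  then show ?thesis using True by (simp add: coded_B_def)
next
  case False
  then show ?thesis
    by (intro poly_fun_cong[OF poly_fun_const[OF zero_closed]]) (auto simp: coded_B_def)
qed

text \<open>The situation at a node y_e: the key coefficients vanish, and what remains is the linear
  form of one term of the decomposition.\<close>

lemma coded_A_unmasked:
  assumes "A \<in> mats R s t" "Ks \<in> mat_list R L a b" "h < s div p" "u < t div m"
    and "\<And>l j. \<alpha> j l \<in> carrier R" "\<And>l j. ca l j = \<alpha> j l" "\<And>u. u < L \<Longrightarrow> ck u = \<zero>"
  shows "coded_A R p m s t L ca ck A Ks h u
    = (\<Oplus>a\<in>{..<p} \<times> {..<m}. \<alpha> (snd a) (fst a) \<otimes> block R (s div p) (t div m) A (fst a) (snd a) h u)"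
proof -
  have "(\<Oplus>u'\<in>{..<L}. ck u' \<otimes> Ks u' h u) = (\<Oplus>u'\<in>{..<L}. \<zero>)"
    using assms(2,7) mat_list_closed by (intro finsum_cong') auto
  then show ?thesis
    using assms block_closed[OF assms(1)] by (simp add: coded_A_def finsum_closed Pi_def)
qed

text \<open>At a node the query is supported on slot \<open>D\<close>, so the sum over triples
  collapses along \<open>Pair D\<close> to the blocks of the requested matrix.\<close>

lemma coded_B_unmasked:
  assumes "Bs \<in> mat_list R M s r" "D < M" "h < s div p" "v < r div n"
    and "\<And>l k. \<beta> l k \<in> carrier R"
    and cq: "\<And>x l k. x < M \<Longrightarrow> l < p \<Longrightarrow> k < n \<Longrightarrow> cq x l k = (if x = D then \<beta> l k else \<zero>)"
  shows "coded_B R p n M s r cq Bs h v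
    = (\<Oplus>b\<in>{..<p} \<times> {..<n}. \<beta> (fst b) (snd b) \<otimes> block R (s div p) (r div n) (Bs D) (fst b) (snd b) h v)"
proof -
  have "(\<Oplus>x\<in>{..<M} \<times> {..<p} \<times> {..<n}. cq (fst x) (fst (snd x)) (snd (snd x)) \<otimes>
            block R (s div p) (r div n) (Bs (fst x)) (fst (snd x)) (snd (snd x)) h v)
    = (\<Oplus>b\<in>{..<p} \<times> {..<n}. \<beta> (fst b) (snd b) \<otimes> block R (s div p) (r div n) (Bs D) (fst b) (snd b) h v)"
  proof (rule finsum_supported_on_image[where h = "Pair D"])
    fix x assume x: "x \<in> {..<M} \<times> {..<p} \<times> {..<n}" "x \<notin> Pair D ` ({..<p} \<times> {..<n})"
    then have "fst x \<noteq> D" by (cases x) auto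
    then have "cq (fst x) (fst (snd x)) (snd (snd x)) = \<zero>"
      using x(1) cq[of "fst x" "fst (snd x)" "snd (snd x)"] by auto
    then show "cq (fst x) (fst (snd x)) (snd (snd x)) \<otimes>
            block R (s div p) (r div n) (Bs (fst x)) (fst (snd x)) (snd (snd x)) h v = \<zero>"
      using block_mat_list_closed[OF assms(1)] by simp
  qed (use assms block_mat_list_closed[OF assms(1)] in \<open>auto simp: inj_on_def\<close>)
  then show ?thesis using assms by (simp add: coded_B_def)
qed

text \<open>Merges the two decoding stages, interpolation at each node and recombination of the node
  values, into one coefficient per worker.\<close>

lemma finsum_decoding:
  assumes fin: "finite S" "finite T"
    and "\<And>r. g r \<in> carrier R" "\<And>r i. c r i \<in> carrier R" "\<And>i. i \<in> S \<Longrightarrow> y i \<in> carrier R"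
  shows "(\<Oplus>i\<in>S. (\<Oplus>r\<in>T. g r \<otimes> c r i) \<otimes> y i) = (\<Oplus>r\<in>T. g r \<otimes> (\<Oplus>i\<in>S. c r i \<otimes> y i))"
proof -
  have "(\<Oplus>i\<in>S. (\<Oplus>r\<in>T. g r \<otimes> c r i) \<otimes> y i) = (\<Oplus>i\<in>S. \<Oplus>r\<in>T. g r \<otimes> c r i \<otimes> y i)"
    using assms by (intro finsum_cong' finsum_ldistr) (auto intro!: finsum_closed)
  also have "\<dots> = (\<Oplus>r\<in>T. \<Oplus>i\<in>S. g r \<otimes> c r i \<otimes> y i)"
    using assms by (intro finsum_swap) auto
  also have "\<dots> = (\<Oplus>r\<in>T. \<Oplus>i\<in>S. g r \<otimes> (c r i \<otimes> y i))"
    using assms by (intro finsum_cong') (auto intro!: finsum_closed simp: m_assoc)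
  also have "\<dots> = (\<Oplus>r\<in>T. g r \<otimes> (\<Oplus>i\<in>S. c r i \<otimes> y i))"
    using assms by (intro finsum_cong' finsum_rdistr[symmetric]) (auto intro!: finsum_closed)
  finally show ?thesis .
qed

text \<open>Writing a row index as block number times block height plus \<open>h\<close> and summing
  over \<open>h\<close> last reduces the claim to scalar matrix products of inner dimension
  \<open>p\<close>, one for each \<open>h\<close>.\<close>

lemma block_tmul:
  assumes "p dvd s" "m dvd t" "n dvd r" and A: "A \<in> mats R s t" and B: "B \<in> mats R s r"
    and j: "j < m" "k < n" and u: "u < t div m" "v < r div n"
  shows "block R (t div m) (r div n) (tmul R s t r A B) j k u v
    = (\<Oplus>h\<in>{..<s div p}. \<Oplus>l\<in>{..<p}. block R (s div p) (t div m) A l j h u \<otimes> block R (s div p) (r div n) B l k h v)"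
proof -
  have less: "i * w + x < a" if "w = a div b" "b dvd a" "i < b" "x < w" for i w x a b :: nat
  proof -
    have "i * w + x < Suc i * w" using that by simp
    also have "\<dots> \<le> b * w" using that by (intro mult_right_mono) auto
    finally show ?thesis using that by simp
  qed
  have lt: "j * (t div m) + u < t" "k * (r div n) + v < r"
    using less[OF refl assms(2) j(1) u(1)] less[OF refl assms(3) j(2) u(2)] by auto
  have s: "s = p * (s div p)" using assms(1) by simp
  have "block R (t div m) (r div n) (tmul R s t r A B) j k u v
      = (\<Oplus>i\<in>{..<p * (s div p)}. A i (j * (t div m) + u) \<otimes> B i (k * (r div n) + v))"
    using lt u assms(1) by (simp add: block_def tmul_def)
  also have "\<dots> = (\<Oplus>l\<in>{..<p}. \<Oplus>h\<in>{..<s div p}. A (l * (s div p) + h) (j * (t div m) + u) \<otimes> B (l * (s div p) + h) (k * (r div n) + v))"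
    by (rule finsum_lessThan_mult) (use mats_closed A B in auto)
  also have "\<dots> = (\<Oplus>h\<in>{..<s div p}. \<Oplus>l\<in>{..<p}. A (l * (s div p) + h) (j * (t div m) + u) \<otimes> B (l * (s div p) + h) (k * (r div n) + v))"
    by (rule finsum_swap) (use mats_closed[OF A] mats_closed[OF B] in auto)
  also have "\<dots> = (\<Oplus>h\<in>{..<s div p}. \<Oplus>l\<in>{..<p}. block R (s div p) (t div m) A l j h u \<otimes> block R (s div p) (r div n) B l k h v)"
    using u mats_closed[OF A] mats_closed[OF B] by (intro finsum_cong') (auto simp: block_def intro!: finsum_closed)
  finally show ?thesis .
qed

text \<open>Entry by entry, the results are values at z_i of a polynomial of degree at most d1 + d2.
  Interpolation gives its values at the nodes, where masks vanish, and \<gamma> combines these into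
  the wanted block.\<close>

lemma decoding_correct:
  assumes dvd: "p dvd s" "m dvd t" "n dvd r"
    and dec: "mm_decomposition R p m n \<rho> \<alpha> \<beta> \<gamma>"
    and CA: "\<And>l j. poly_fun R d1 (\<lambda>x. CA x l j)" and CK: "\<And>u. u < L \<Longrightarrow> poly_fun R d1 (\<lambda>x. CK x u)"
    and CQ: "\<And>x l k. poly_fun R d2 (\<lambda>z. CQ z x l k)"
    and y: "\<And>i. i < \<rho> \<Longrightarrow> y i \<in> carrier R"
    and CAy: "\<And>i l j. i < \<rho> \<Longrightarrow> CA (y i) l j = \<alpha> i j l"
    and CKy: "\<And>i u. i < \<rho> \<Longrightarrow> u < L \<Longrightarrow> CK (y i) u = \<zero>"
    and CQy: "\<And>i x l k. i < \<rho> \<Longrightarrow> x < M \<Longrightarrow> l < p \<Longrightarrow> k < n \<Longrightarrow> CQ (y i) x l k = (if x = D then \<beta> i l k else \<zero>)"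
    and S: "finite S" "\<And>i. i \<in> S \<Longrightarrow> z i \<in> carrier R"
    and c: "\<And>e i. c e i \<in> carrier R"
      "\<And>e h. e < \<rho> \<Longrightarrow> poly_fun R (d1 + d2) h \<Longrightarrow> h (y e) = (\<Oplus>i\<in>S. c e i \<otimes> h (z i))"
    and A: "A \<in> mats R s t" and Bs: "Bs \<in> mat_list R M s r" and D: "D < M"
    and Ks: "Ks \<in> mat_list R L (s div p) (t div m)" and jk: "j < m" "k < n"
  shows "block R (t div m) (r div n) (tmul R s t r A (Bs D)) j k =
    lincomb R (t div m) (r div n) S (\<lambda>i. \<Oplus>e\<in>{..<\<rho>}. \<gamma> e j k \<otimes> c e i)
      (\<lambda>i. tmul R (s div p) (t div m) (r div n) (coded_A R p m s t L (CA (z i)) (CK (z i)) A Ks)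
             (coded_B R p n M s r (CQ (z i)) Bs))" (is "_ = ?rhs")
proof (intro ext)
  fix u v
  have cl: "\<And>r j l. \<alpha> r j l \<in> carrier R" "\<And>r l k. \<beta> r l k \<in> carrier R" "\<And>r j k. \<gamma> r j k \<in> carrier R"
    using dec by (auto simp: mm_decomposition_def)
  show "block R (t div m) (r div n) (tmul R s t r A (Bs D)) j k u v = ?rhs u v"
  proof (cases "u < t div m \<and> v < r div n")
    case False
    then show ?thesis by (auto simp: block_def lincomb_def)
  next
    case True
    then have uv: "u < t div m" "v < r div n" by auto
    let ?X = "\<lambda>h a. block R (s div p) (t div m) A (fst a) (snd a) h u"
      and ?Z = "\<lambda>h b. block R (s div p) (r div n) (Bs D) (fst b) (snd b) h v"
    \<comment> \<open>\<open>P x h\<close> is the contribution of inner row \<open>h\<close> to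
      entry (u, v) of the worker product. The decomposition applies to each \<open>h\<close>
      separately, so \<open>P\<close> is treated before its sum \<open>H\<close>.\<close>
    define P where "P x h = coded_A R p m s t L (CA x) (CK x) A Ks h u \<otimes> coded_B R p n M s r (CQ x) Bs h v" for x h
    define H where "H x = (\<Oplus>h\<in>{..<s div p}. P x h)" for x
    have P: "poly_fun R (d1 + d2) (\<lambda>x. P x h)" for h
      unfolding P_def by (intro poly_fun_mult poly_fun_coded_A[OF A Ks CA CK] poly_fun_coded_B[OF Bs CQ])
    have H: "poly_fun R (d1 + d2) H"
      unfolding H_def by (rule poly_fun_finsum) (simp, rule P)
    have Py: "P (y e) h = (\<Oplus>a\<in>{..<p} \<times> {..<m}. \<alpha> e (snd a) (fst a) \<otimes> ?X h a)
        \<otimes> (\<Oplus>b\<in>{..<p} \<times> {..<n}. \<beta> e (fst b) (snd b) \<otimes> ?Z h b)"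
      if "e < \<rho>" "h < s div p" for e h
      unfolding P_def
      using coded_A_unmasked[OF A Ks that(2) uv(1), of "\<alpha> e" "CA (y e)" "CK (y e)"]
        coded_B_unmasked[OF Bs D that(2) uv(2), of "\<beta> e" "CQ (y e)"] cl CAy[OF that(1)] CKy[OF that(1)] CQy[OF that(1)]
      by simp
    have Pcl: "P x h \<in> carrier R" if "x \<in> carrier R" for x h
      using poly_fun_closed[OF P that] .
    have "?rhs u v = (\<Oplus>i\<in>S. (\<Oplus>e\<in>{..<\<rho>}. \<gamma> e j k \<otimes> c e i) \<otimes> H (z i))"
      using uv by (simp add: lincomb_def tmul_def H_def P_def)
    also have "\<dots> = (\<Oplus>e\<in>{..<\<rho>}. \<gamma> e j k \<otimes> (\<Oplus>i\<in>S. c e i \<otimes> H (z i)))"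
      using S cl c(1) poly_fun_closed[OF H] by (intro finsum_decoding) auto
    also have "\<dots> = (\<Oplus>e\<in>{..<\<rho>}. \<Oplus>h\<in>{..<s div p}. \<gamma> e j k \<otimes> P (y e) h)"
    proof (rule finsum_cong'[OF refl])
      fix e assume e: "e \<in> {..<\<rho>}"
      then have "(\<Oplus>i\<in>S. c e i \<otimes> H (z i)) = H (y e)" using c(2)[OF _ H] by simp
      then show "\<gamma> e j k \<otimes> (\<Oplus>i\<in>S. c e i \<otimes> H (z i)) = (\<Oplus>h\<in>{..<s div p}. \<gamma> e j k \<otimes> P (y e) h)"
        using Pcl y e cl by (simp add: H_def finsum_rdistr Pi_def)
    qed (use Pcl y cl in \<open>auto intro!: finsum_closed\<close>)
    \<comment> \<open>For fixed \<open>h\<close> the inner sum is now the one in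
      \<open>mm_decomposition_product\<close>.\<close>
    also have "\<dots> = (\<Oplus>h\<in>{..<s div p}. \<Oplus>e\<in>{..<\<rho>}. \<gamma> e j k \<otimes> P (y e) h)"
      using Pcl y cl by (intro finsum_swap) auto
    also have "\<dots> = (\<Oplus>h\<in>{..<s div p}. \<Oplus>l\<in>{..<p}. ?X h (l, j) \<otimes> ?Z h (l, k))"
    proof (rule finsum_cong'[OF refl])
      fix h assume h: "h \<in> {..<s div p}"
      have "(\<Oplus>e\<in>{..<\<rho>}. \<gamma> e j k \<otimes> P (y e) h)
        = (\<Oplus>e\<in>{..<\<rho>}. \<gamma> e j k \<otimes> ((\<Oplus>a\<in>{..<p} \<times> {..<m}. \<alpha> e (snd a) (fst a) \<otimes> ?X h a)
        \<otimes> (\<Oplus>b\<in>{..<p} \<times> {..<n}. \<beta> e (fst b) (snd b) \<otimes> ?Z h b)))"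
        using Py h Pcl y cl by (intro finsum_cong') (auto simp: Py[symmetric])
      also have "\<dots> = (\<Oplus>l\<in>{..<p}. ?X h (l, j) \<otimes> ?Z h (l, k))"
        by (rule mm_decomposition_product[OF dec jk]) (use block_closed[OF A] block_mat_list_closed[OF Bs] in auto)
      finally show "(\<Oplus>e\<in>{..<\<rho>}. \<gamma> e j k \<otimes> P (y e) h) = (\<Oplus>l\<in>{..<p}. ?X h (l, j) \<otimes> ?Z h (l, k))" .
    qed (use block_closed[OF A] block_mat_list_closed[OF Bs] in \<open>auto intro!: finsum_closed\<close>)
    also have "\<dots> = block R (t div m) (r div n) (tmul R s t r A (Bs D)) j k u v"
    proof -
      have "Bs D \<in> mats R s r" using Bs D by (auto simp: mat_list_def dest: spec[of _ D])
      from block_tmul[OF dvd A this jk uv] show ?thesis by simp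
    qed
    finally show ?thesis ..
  qed
qed

end

section \<open>The scheme\<close>

context field begin

text \<open>The coefficients depend on the responding set and the node but not on the interpolated
  polynomial, so the decoder can be fixed without knowing the data.\<close>

lemma interpolation_coefficients:
  fixes N \<rho> :: nat
  assumes z: "\<And>i. i < N \<Longrightarrow> z i \<in> carrier R" "inj_on z {..<N}" and y: "\<And>e. e < \<rho> \<Longrightarrow> y e \<in> carrier R"
  shows "\<exists>c. (\<forall>S e i. c S e i \<in> carrier R) \<and>
    (\<forall>S e h. S \<subseteq> {..<N} \<longrightarrow> card S = Suc d \<longrightarrow> e < \<rho> \<longrightarrow> poly_fun R d h \<longrightarrow>
      h (y e) = (\<Oplus>i\<in>S. c S e i \<otimes> h (z i)))"
proof -
  let ?P = "\<lambda>S e c. (\<forall>i. c i \<in> carrier R) \<and> (S \<subseteq> {..<N} \<longrightarrow> card S = Suc d \<longrightarrow> e < \<rho> \<longrightarrow>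
    (\<forall>h. poly_fun R d h \<longrightarrow> h (y e) = (\<Oplus>i\<in>S. c i \<otimes> h (z i))))"
  have ex: "\<exists>c. ?P S e c" for S e
  proof (cases "S \<subseteq> {..<N} \<and> card S = Suc d \<and> e < \<rho>")
    case True
    then have S: "S \<subseteq> {..<N}" "card S = Suc d" "e < \<rho>" by auto
    then have "z ` S \<subseteq> carrier R" using z(1) by auto
    from poly_fun_interpolation[OF finite_subset[OF S(1) finite_lessThan] S(2)
        inj_on_subset[OF z(2) S(1)] this y[OF S(3)]]
    show ?thesis by auto
  next
    case False
    \<comment> \<open>Zero is a default for irrelevant \<open>S\<close> and \<open>e\<close>: the
      scheme asks for decoding coefficients in the carrier for every \<open>S\<close>.\<close>
    then show ?thesis by (intro exI[of _ "\<lambda>i. \<zero>"]) auto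
  qed
  define c where "c S e = (SOME c. ?P S e c)" for S e
  have "?P S e (c S e)" for S e
    unfolding c_def by (rule someI_ex[OF ex])
  then show ?thesis by (intro exI[of _ c]) blast
qed

lemma lagrange_family:
  assumes "inj_on y {..<n}" "y ` {..<n} \<subseteq> carrier R"
  shows "\<exists>l. \<forall>r<n. poly_fun R (n - 1) (l r) \<and> (\<forall>r'<n. l r (y r') = (if r' = r then \<one> else \<zero>))"
proof -
  have "\<forall>r. \<exists>l. r < n \<longrightarrow> poly_fun R (n - 1) l \<and> (\<forall>r'<n. l (y r') = (if r' = r then \<one> else \<zero>))"
    using poly_fun_lagrange[OF assms] by blast
  from choice[OF this] show ?thesis by blast
qed

text \<open>One construction serves both claims, \<open>L\<close> being the number of keys: the
  coded \<open>A\<close> has degree at most \<rho> - 1 + L and the coded \<open>B\<close> at most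
  \<rho>, so 2 \<rho> + L values suffice.\<close>

lemma linear_scheme_exists_threshold:
  assumes fin: "finite (carrier R)" and M: "M \<ge> 1"
    and dvd: "p dvd s" "m dvd t" "n dvd r"
    and dec: "mm_decomposition R p m n \<rho> \<alpha> \<beta> \<gamma>" and \<rho>: "\<rho> \<ge> 1"
    and card: "card (carrier R) \<ge> N + \<rho>"
    and L: "L = (if secure then 1 else 0)"
  shows "linear_scheme_exists secure R p m n M N s t r (2 * \<rho> + L)"
proof -
  have cl: "\<And>r j l. \<alpha> r j l \<in> carrier R" "\<And>r l k. \<beta> r l k \<in> carrier R" "\<And>r j k. \<gamma> r j k \<in> carrier R"
    using dec by (auto simp: mm_decomposition_def)
  \<comment> \<open>Of these distinct points the first \<open>N\<close> go to the workers and the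
    last \<rho> to the nodes, so no worker sits at a zero of the mask.\<close>
  obtain e where e: "inj_on e {..<N + \<rho>}" "e ` {..<N + \<rho>} \<subseteq> carrier R"
    using card_le_inj[of "{..<N + \<rho>}" "carrier R"] fin card by auto
  define z where "z i = e i" for i
  define y where "y i = e (N + i)" for i
  have z: "z i \<in> carrier R" if "i < N" for i using e that by (auto simp: z_def)
  have y: "y i \<in> carrier R" if "i < \<rho>" for i using e that by (auto simp: y_def)
  have injz: "inj_on z {..<N}" using e by (auto simp: z_def inj_on_def)
  have injy: "inj_on y {..<\<rho>}"
  proof (rule inj_onI)
    fix i i' assume "i \<in> {..<\<rho>}" "i' \<in> {..<\<rho>}" "y i = y i'"
    then show "i = i'" using inj_onD[OF e(1), of "N + i" "N + i'"] by (simp add: y_def)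
  qed
  have y': "y ` {..<\<rho>} \<subseteq> carrier R" using y by auto
  have zy: "z i \<notin> y ` {..<\<rho>}" if "i < N" for i
  proof
    assume "z i \<in> y ` {..<\<rho>}"
    then obtain i' where "i' < \<rho>" "e i = e (N + i')" by (auto simp: z_def y_def)
    with inj_onD[OF e(1), of i "N + i'"] that show False by auto
  qed
  obtain \<ll> where \<ll>: "\<And>e. e < \<rho> \<Longrightarrow> poly_fun R (\<rho> - 1) (\<ll> e)"
    "\<And>e e'. e < \<rho> \<Longrightarrow> e' < \<rho> \<Longrightarrow> \<ll> e (y e') = (if e' = e then \<one> else \<zero>)"
    using lagrange_family[OF injy y'] by blast
  have "card (y ` {..<\<rho>}) = \<rho>" using injy by (simp add: card_image)
  then obtain w where w: "poly_fun R \<rho> w" "\<And>x. x \<in> carrier R \<Longrightarrow> w x = \<zero> \<longleftrightarrow> x \<in> y ` {..<\<rho>}"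
    using poly_fun_vanishing[OF _ y'] by auto
  have wz: "w (z i) \<in> carrier R" "w (z i) \<noteq> \<zero>" if "i < N" for i
    using w(2)[OF z[OF that]] zy[OF that] poly_fun_closed[OF w(1) z[OF that]] by auto
  have wy: "w (y i) = \<zero>" if "i < \<rho>" for i
    using w(2)[OF y[OF that]] that by auto
  define d1 where "d1 = \<rho> - 1 + L"
  obtain c where c': "(\<forall>S e i. c S e i \<in> carrier R) \<and>
    (\<forall>S e h. S \<subseteq> {..<N} \<longrightarrow> card S = Suc (d1 + \<rho>) \<longrightarrow> e < \<rho> \<longrightarrow> poly_fun R (d1 + \<rho>) h \<longrightarrow>
      h (y e) = (\<Oplus>i\<in>S. c S e i \<otimes> h (z i)))"
    using interpolation_coefficients[OF z injz y, where d = "d1 + \<rho>"] by (rule exE)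
  note c = c'[THEN conjunct1, rule_format] c'[THEN conjunct2, rule_format]
  define I where "I = {..<M} \<times> {..<p} \<times> {..<n}"
  define CA where "CA x l j = (\<Oplus>e\<in>{..<\<rho>}. \<ll> e x \<otimes> \<alpha> e j l)" for x l j
  define CK where "CK x u = w x" for x and u :: nat
  \<comment> \<open>The query before masking: Lagrange combinations of \<beta> in slot
    \<open>D\<close>, zero in the other slots.\<close>
  define B where "B D x = (\<lambda>(a, l, k). if a = D then \<Oplus>e\<in>{..<\<rho>}. \<ll> e x \<otimes> \<beta> e l k else \<zero>)" for D :: nat and x
  define CQ where "CQ D \<omega> x a l k = (if (a, l, k) \<in> I then B D x (a, l, k) \<oplus> w x \<otimes> \<omega> (encode3 (a, l, k)) else \<zero>)"
    for D :: nat and \<omega> x a l k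
  \<comment> \<open>The master's randomness is one uniform mask coefficient for each triple in
    \<open>I\<close>, shared by all workers; each worker sees it scaled by its own w(z_i).\<close>
  define \<mu> where "\<mu> = pmf_of_set (supported_funs R (encode3 ` I))"
  have finI: "finite I" by (simp add: I_def)
  have set\<mu>: "set_pmf \<mu> = supported_funs R (encode3 ` I)"
    unfolding \<mu>_def using fin finI
    by (intro set_pmf_of_set supported_funs_nonempty finite_supported_funs) auto
  have \<omega>: "\<omega> x \<in> carrier R" if "\<omega> \<in> set_pmf \<mu>" for \<omega> x
    using that unfolding set\<mu> supported_funs_def by (cases "x \<in> encode3 ` I") auto
  have CAp: "poly_fun R d1 (\<lambda>x. CA x l j)" for l j
    unfolding CA_def
    by (rule poly_fun_finsum, simp, rule poly_fun_smult_right[OF cl(1)], rule poly_fun_mono[OF \<ll>(1)])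
      (auto simp: d1_def)
  have CKp: "poly_fun R d1 (\<lambda>x. CK x u)" if "u < L" for u
    \<comment> \<open>A key index exists only for L = 1, and then d1 = \<rho> because \<rho> is
      positive.\<close>
    unfolding CK_def by (rule poly_fun_mono[OF w(1)]) (use that L \<rho> in \<open>auto simp: d1_def split: if_splits\<close>)
  have Bp: "poly_fun R \<rho> (\<lambda>x. B D x (a, l, k))" for D a l k
  proof (cases "a = D")
    case True
    have "poly_fun R \<rho> (\<lambda>x. \<Oplus>e\<in>{..<\<rho>}. \<ll> e x \<otimes> \<beta> e l k)"
      by (rule poly_fun_finsum, simp, rule poly_fun_smult_right[OF cl(2)], rule poly_fun_mono[OF \<ll>(1)]) auto
    then show ?thesis using True by (simp add: B_def)
  qed (simp add: B_def poly_fun_const)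
  have CQp: "poly_fun R \<rho> (\<lambda>x. CQ D \<omega> x a l k)" if "\<omega> \<in> set_pmf \<mu>" for D \<omega> a l k
  proof (cases "(a, l, k) \<in> I")
    case True
    have "poly_fun R \<rho> (\<lambda>x. B D x (a, l, k) \<oplus> w x \<otimes> \<omega> (encode3 (a, l, k)))"
      by (intro poly_fun_add Bp poly_fun_smult_right \<omega>[OF that] w(1))
    then show ?thesis using True by (simp add: CQ_def)
  qed (simp add: CQ_def poly_fun_const)
  have lagrange_sum: "(\<Oplus>e\<in>{..<\<rho>}. \<ll> e (y i) \<otimes> g e) = g i" if "i < \<rho>" "\<And>e. g e \<in> carrier R" for i g
  proof -
    have "(\<Oplus>e\<in>{..<\<rho>}. \<ll> e (y i) \<otimes> g e) = (\<Oplus>e\<in>{..<\<rho>}. if i = e then g e else \<zero>)"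
      using that by (intro finsum_cong') (auto simp: \<ll>(2))
    also have "\<dots> = g i" using that by (intro finsum_singleton) auto
    finally show ?thesis .
  qed
  have CAy: "CA (y i) l j = \<alpha> i j l" if "i < \<rho>" for i l j
    unfolding CA_def using that cl(1) by (rule lagrange_sum)
  have CKy: "CK (y i) u = \<zero>" if "i < \<rho>" for i u
    unfolding CK_def using that by (rule wy)
  have By: "B D (y i) (a, l, k) = (if a = D then \<beta> i l k else \<zero>)" if "i < \<rho>" for D i a l k
    unfolding B_def using lagrange_sum[OF that, of "\<lambda>e. \<beta> e l k"] cl by simp
  have CQy: "CQ D \<omega> (y i) a l k = (if a = D then \<beta> i l k else \<zero>)"
    if "\<omega> \<in> set_pmf \<mu>" "i < \<rho>" "a < M" "l < p" "k < n" for D \<omega> i a l k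
    using that \<omega>[OF that(1)] wy By cl by (simp add: CQ_def I_def)
  \<comment> \<open>The coefficients for \<open>A\<close> ignore the request and the query
    randomness, as \<open>mutual_information_request_eq_0\<close> requires.\<close>
  define ca where "ca i D \<omega> = CA (z i)" for i and D :: nat and \<omega> :: "nat \<Rightarrow> 'a"
  define ck where "ck i D \<omega> = CK (z i)" for i and D :: nat and \<omega> :: "nat \<Rightarrow> 'a"
  define q where "q i D \<omega> = CQ D \<omega> (z i)" for i D \<omega>
  define d where "d S D \<omega> j k i = (\<Oplus>e\<in>{..<\<rho>}. \<gamma> e j k \<otimes> c S e i)"
    for S and D :: nat and \<omega> :: "nat \<Rightarrow> 'a" and j k i
  have K: "2 * \<rho> + L = Suc (d1 + \<rho>)" using \<rho> by (simp add: d1_def)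
  show ?thesis
    unfolding linear_scheme_exists_def Let_def
  proof (rule exI[of _ L], rule exI[of _ \<mu>], rule exI[of _ ca], rule exI[of _ ck], rule exI[of _ q],
      rule exI[of _ d], intro conjI allI impI)
    fix i D \<omega> l j u assume i: "i < N"
    show "ca i D \<omega> l j \<in> carrier R"
      unfolding ca_def by (rule poly_fun_closed[OF CAp z[OF i]])
    show "ck i D \<omega> u \<in> carrier R"
      unfolding ck_def CK_def by (rule wz(1)[OF i])
  next
    fix i D \<omega> x l k assume i: "i < N" and w': "\<omega> \<in> set_pmf \<mu>"
    show "q i D \<omega> x l k \<in> carrier R"
      unfolding q_def by (rule poly_fun_closed[OF CQp[OF w'] z[OF i]])
  next
    fix S D \<omega> j k i
    show "d S D \<omega> j k i \<in> carrier R"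
      using cl c(1) by (auto simp: d_def intro!: finsum_closed)
  next
    fix A Bs D Ks \<omega> S j k
    assume A: "A \<in> mats R s t" "Bs \<in> mat_list R M s r" "D < M"
      "Ks \<in> mat_list R L (s div p) (t div m)" and w': "\<omega> \<in> set_pmf \<mu>"
      and S: "S \<subseteq> {..<N}" "card S = 2 * \<rho> + L" and jk: "j < m" "k < n"
    show "block R (t div m) (r div n) (tmul R s t r A (Bs D)) j k =
      lincomb R (t div m) (r div n) S (d S D \<omega> j k)
       (\<lambda>i. tmul R (s div p) (t div m) (r div n)
         (coded_A R p m s t L (ca i D \<omega>) (ck i D \<omega>) A Ks)
         (coded_B R p n M s r (q i D \<omega>) Bs))"
      unfolding d_def ca_def ck_def q_def
    proof (rule decoding_correct[OF dvd dec, where y = y and ?d1.0 = d1 and ?d2.0 = \<rho>])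
      show "finite S" using S(1) by (rule finite_subset) simp
      show "h (y e) = (\<Oplus>i\<in>S. c S e i \<otimes> h (z i))" if "e < \<rho>" "poly_fun R (d1 + \<rho>) h" for e h
        using c(2)[OF S(1) _ that] S(2) K by simp
    qed (use A jk CAp CKp CQp[OF w'] y CAy CKy CQy[OF w'] S(1) z c(1) in auto)
  next
    fix i assume i: "i < N"
    show "prob_space.mutual_information (measure_pmf (pm_experiment R p m M s t r L \<mu>)) 2
        (count_space UNIV) (count_space UNIV) (\<lambda>(A, Bs, D, Ks, \<omega>). D)
        (\<lambda>(A, Bs, D, Ks, \<omega>). (q i D \<omega>, coded_A R p m s t L (ca i D \<omega>) (ck i D \<omega>) A Ks, Bs)) = 0"
      unfolding ca_def ck_def
    proof (rule mutual_information_request_eq_0[OF M])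
      fix D
      have "B D (z i) x \<in> carrier R" if "x \<in> I" for x
        using poly_fun_closed[OF Bp z[OF i]] by (cases x) auto
      from map_pmf_masked_query[OF fin finI wz[OF i] this]
      \<comment> \<open>The common law is that of the bare mask, the same for every
        \<open>D\<close>.\<close>
      show "map_pmf (q i D) \<mu> = map_pmf (\<lambda>\<omega> x l k. if (x, l, k) \<in> I then \<omega> (encode3 (x, l, k)) else \<zero>) \<mu>"
        unfolding \<mu>_def q_def CQ_def by simp
    qed
  next
    fix i assume secure and i: "i < N"
    then have L1: "L = 1" using L by simp
    show "prob_space.mutual_information (measure_pmf (pm_experiment R p m M s t r L \<mu>)) 2
        (count_space UNIV) (count_space UNIV)
        (\<lambda>(A, Bs, D, Ks, \<omega>). coded_A R p m s t L (ca i D \<omega>) (ck i D \<omega>) A Ks)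
        (\<lambda>(A, Bs, D, Ks, \<omega>). A) = 0"
      unfolding ca_def ck_def L1
    proof (rule mutual_information_data_eq_0)
      show "map_pmf (coded_A R p m s t 1 (CA (z i)) (CK (z i)) A) (pmf_of_set (mat_list R 1 (s div p) (t div m)))
        = pmf_of_set (mats R (s div p) (t div m))" if "A \<in> mats R s t" for A
        using poly_fun_closed[OF CAp z[OF i]] wz[OF i]
        by (intro map_pmf_coded_A fin that) (auto simp: CK_def)
    qed (simp_all add: finite_mats fin mats_nonempty)
  qed
qed

end

theorem theorem2:
  fixes p m n M N :: nat
  assumes "p \<ge> 1" and "m \<ge> 1" and "n \<ge> 1" and "M \<ge> 1"
  shows "\<exists>q0::nat. \<forall>F::'c ring. field F \<and> finite (carrier F) \<and> card (carrier F) \<ge> q0 \<longrightarrow>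
           (\<forall>s t r. p dvd s \<and> m dvd t \<and> n dvd r \<longrightarrow>
              linear_scheme_exists False F p m n M N s t r (2 * mm_rank F p m n) \<and>
              linear_scheme_exists True F p m n M N s t r (2 * mm_rank F p m n + 1))"
\<comment> \<open>The field size must be chosen before the field, on which the rank depends; the
  schoolbook bound p m n replaces the rank.\<close>
proof (intro exI[of _ "N + p * m * n"] allI impI; elim conjE)
  fix F :: "'c ring" and s t r
  assume F: "field F" "finite (carrier F)" "N + p * m * n \<le> card (carrier F)"
    and dvd: "p dvd s" "m dvd t" "n dvd r"
  interpret field F by fact
  obtain \<alpha> \<beta> \<gamma> where dec: "mm_decomposition F p m n (mm_rank F p m n) \<alpha> \<beta> \<gamma>"
    using mm_rank_decomposition by blast
  have "N + mm_rank F p m n \<le> card (carrier F)"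
    using mm_rank_le[of p m n] F(3) by simp
  note scheme = linear_scheme_exists_threshold[OF F(2) assms(4) dvd dec mm_rank_pos[OF assms(1-3)] this refl]
  show "linear_scheme_exists False F p m n M N s t r (2 * mm_rank F p m n) \<and>
      linear_scheme_exists True F p m n M N s t r (2 * mm_rank F p m n + 1)"
    using scheme[of False] scheme[of True] by simp
qed

end
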